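(* Let $p$ be an odd prime, $e$ a positive integer with $e\equiv0\pmod4$, $q=p^e$, and $i\in\{0,1\}$ with Legendre symbol $\left(\frac{e}{p}\right)=(-1)^i$. Let $D_i=\{x\in\mathbb{F}_q:\mathrm{Tr}(x^{p+1}-x)\in C_i^{(2,p)}\}$ and $\mathcal{C}_{D_i}=\{(\mathrm{Tr}(ax))_{x\in D_i}:a\in\mathbb{F}_q\}$. Then $\mathcal{C}_{D_i}$ has length $\frac{p-1}{2}p^{e-1}-\frac{1+\eta(-1)p}{2}p^{\frac e2}$ and dimension $e$, it has at most $6$ nonzero weights, and with $W=\frac{(p-1)^2}{2}p^{e-2}$ its weight distribution (weight: number of codewords) is: (a) if $p\equiv1\pmod4$: - $0$: $1$; - $W-\frac{p^2-1}{2}p^{\frac e2-1}$: $p^e-p^{e-2}$; - $W$: $p^{e-4}-1$; - $W-\frac{p+1}{2}p^{\frac e2}$: $\frac{p^2-1}{2}p^{e-4}-(p-1)p^{\frac e2-2}$; - $W-\frac{p+3}{2}p^{\frac e2}$: $\frac{(p-1)(p-3)}{4}p^{e-4}-\frac{(p-1)(p-3)}{4}p^{\frac e2-2}$; - $W-\frac{p-1}{2}p^{\frac e2}$: $\frac{p^2-1}{4}p^{e-4}+\frac{p^2-1}{4}p^{\frac e2-2}$; - $W-p^{\frac e2}$: $(p-1)p^{e-4}$; (b) if $p\equiv3\pmod4$: - $0$: $1$; - $W+\frac{(p-1)^2}{2}p^{\frac e2-1}$: $p^e-p^{e-2}$; - $W$: $p^{e-3}-1$; - $W+\frac{p-1}{2}p^{\frac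 e2}$: $\frac{p^2-1}{2}p^{e-4}$; - $W+\frac{p-3}{2}p^{\frac e2}$: $\frac{(p-1)^2}{4}p^{e-4}-\frac{(p-1)^2}{4}p^{\frac e2-2}$; - $W+\frac{p+1}{2}p^{\frac e2}$: $\frac{(p-1)^2}{4}p^{e-4}+\frac{(p-1)^2}{4}p^{\frac e2-2}$.
   Context: $\mathrm{Tr}$ is the absolute trace $\mathbb{F}_q\to\mathbb{F}_p$. $C_0^{(2,p)}$ (resp. $C_1^{(2,p)}$) is the set of squares (resp. non-squares) in $\mathbb{F}_p^*$. $\eta$ is the quadratic character of $\mathbb{F}_p^*$. $\left(\frac{\cdot}{p}\right)$ is the Legendre symbol. Weights are Hamming weights. *)

theory Defs
  imports "HOL-Number_Theory.Number_Theory" "HOL-Library.Cardinality"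
begin

text \<open>Absolute trace F_q -> F_p, q = p^e, with F_p identified with the prime subfield.\<close>
definition abs_trace :: "nat \<Rightarrow> nat \<Rightarrow> 'a::field \<Rightarrow> 'a" where
  "abs_trace p e x = (\<Sum>j<e. x ^ (p ^ j))"

definition prime_subfield :: "'a::field set" where
  "prime_subfield = range of_nat"

definition cyc2 :: "nat \<Rightarrow> 'a::field set" where
  "cyc2 i = (if i = 0 then {y. \<exists>z\<in>prime_subfield. z \<noteq> 0 \<and> y = z ^ 2}
             else (prime_subfield - {0}) - {y. \<exists>z\<in>prime_subfield. z \<noteq> 0 \<and> y = z ^ 2})"

definition defset :: "nat \<Rightarrow> nat \<Rightarrow> nat \<Rightarrow> 'a::{field,finite} set" where
  "defset p e i = {x. abs_trace p e (x ^ (p + 1) - x) \<in> cyc2 i}"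

definition codeword :: "nat \<Rightarrow> nat \<Rightarrow> 'a set \<Rightarrow> 'a::{field,finite} \<Rightarrow> 'a \<Rightarrow> 'a" where
  "codeword p e D a = (\<lambda>x. if x \<in> D then abs_trace p e (a * x) else 0)"

definition code :: "nat \<Rightarrow> nat \<Rightarrow> 'a set \<Rightarrow> ('a::{field,finite} \<Rightarrow> 'a) set" where
  "code p e D = range (codeword p e D)"

definition hweight :: "'a set \<Rightarrow> ('a \<Rightarrow> 'b::zero) \<Rightarrow> nat" where
  "hweight D c = card {x\<in>D. c x \<noteq> 0}"

end

theory Submission
  imports Defs "HOL-Computational_Algebra.Polynomial"
begin

text \<open>
  The map \<open>Q x = Tr (x\<^sup>p\<^sup>+\<^sup>1)\<close> is a quadratic form over \<open>F\<^sub>p\<close> whose radical has dimension two, since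
  \<open>4\<close> divides \<open>e\<close>. Its level sets are counted without exponential sums: the norm
  \<open>GF(p\<^sup>2) \<rightarrow> F\<^sub>p\<close> is onto, so all nonzero levels have the same size; the second moment fixes the
  difference \<open>#{Q = 0} - #{Q = 1}\<close> up to sign; and the sign follows because the nonzero zeros of \<open>Q\<close>
  are permuted freely by the units of the subfield of order \<open>p\<^sup>2\<close>.

  Completing the square gives \<open>Tr (x\<^sup>p\<^sup>+\<^sup>1 - x) = Q (x - 1/2) - e/4\<close>. A functional \<open>Tr (a x)\<close> that
  does not vanish on the radical is equidistributed on the defining set. Otherwise it is \<open>B(b, x)\<close>
  for the polar form \<open>B\<close> of \<open>Q\<close>, and the weight of \<open>a\<close> depends only on the quadratic characters of
  \<open>e Q(b)\<close> and \<open>B(b, 1/2)\<^sup>2 - e Q(b)\<close>; the number of \<open>b\<close> with prescribed \<open>Q(b)\<close> and \<open>B(b, 1/2)\<close> is an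
  instance of the same count.
\<close>

section \<open>Counting fibres and roots\<close>

lemma card_eq_sum_fibres:
  assumes "finite A" "finite T" "\<And>x. x \<in> A \<Longrightarrow> g x \<in> T"
  shows "card A = (\<Sum>y\<in>T. card {x \<in> A. g x = y})"
proof -
  have "(\<Sum>y\<in>T. \<Sum>x\<in>{x \<in> A. g x = y}. 1) = (\<Sum>x\<in>A. 1 :: nat)"
    using assms by (intro sum.group) auto
  then show ?thesis by simp
qed

lemma card_fibre_additive:
  fixes f :: "'a::ab_group_add \<Rightarrow> 'b::ab_group_add"
  assumes add: "\<And>x y. f (x + y) = f x + f y" and y: "y \<in> range f"
  shows "card {x. f x = y} = card {x. f x = 0}"
proof -
  obtain x0 where x0: "y = f x0" using y by auto
  have f0: "f (x - x0) = f x - f x0" for x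
    using add[of "x - x0" x0] by (simp add: algebra_simps)
  have "bij_betw (\<lambda>x. x + x0) {x. f x = 0} {x. f x = y}"
    by (rule bij_betw_byWitness[where f' = "\<lambda>x. x - x0"]) (auto simp: f0 x0 add)
  then show ?thesis by (simp add: bij_betw_same_card)
qed

lemma card_additive:
  fixes f :: "'a::{ab_group_add,finite} \<Rightarrow> 'b::ab_group_add"
  assumes add: "\<And>x y. f (x + y) = f x + f y"
  shows "CARD('a) = card (range f) * card {x. f x = 0}"
proof -
  have "CARD('a) = (\<Sum>y\<in>range f. card {x \<in> UNIV. f x = y})"
    by (rule card_eq_sum_fibres) auto
  also have "\<dots> = (\<Sum>y\<in>range f. card {x. f x = 0})"
    using card_fibre_additive[of f, OF add] by (intro sum.cong) auto
  finally show ?thesis by simp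
qed

text \<open>Upgrades two upper bounds to equalities. It is applied where the sizes of an image and a
  kernel are each bounded above and their product is known.\<close>

lemma mult_eq_of_le:
  fixes a b c d :: nat
  assumes "c * d = a * b" "c \<le> a" "d \<le> b" "a > 0" "b > 0"
  shows "c = a" "d = b"
proof -
  have "a * b \<le> a * d" using assms mult_le_mono1[of c a d] by linarith
  then show d: "d = b" using assms(3,4) by simp
  show "c = a" using assms(1,5) unfolding d by simp
qed

lemma card_roots_le:
  fixes P :: "'a::field poly"
  assumes "coeff P n \<noteq> 0" "degree P \<le> n" "A \<subseteq> {x. poly P x = 0}"
  shows "card A \<le> n"
proof -
  have nz: "P \<noteq> 0" using assms(1) by auto
  have "card A \<le> card {x. poly P x = 0}"
    using assms(3) nz by (intro card_mono) (auto intro: poly_roots_finite)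
  also have "\<dots> \<le> degree P" using nz by (rule card_poly_roots_bound)
  finally show ?thesis using assms(2) by linarith
qed

text \<open>The quadratic character of F_p, zero at 0 and integer valued so that character sums live
  in the integers. The root is sought in the prime subfield because for even \<open>e\<close> every
  element of F_p is a square in the large field.\<close>

definition qchar :: "'a::field \<Rightarrow> int" where
  "qchar x = (if x = 0 then 0 else if \<exists>z\<in>prime_subfield. x = z\<^sup>2 then 1 else -1)"

section \<open>Frobenius map, prime subfield and absolute trace\<close>

locale trace_field =
  fixes p e :: nat and F :: "'a::{field,finite} itself"
  assumes prime_p: "prime p" and odd_p: "odd p" and e_pos: "e > 0" and e_mod_4: "e mod 4 = 0"
    and card_field: "CARD('a) = p ^ e"
begin

abbreviation Fp :: "'a set" where "Fp \<equiv> prime_subfield"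
abbreviation Tr :: "'a \<Rightarrow> 'a" where "Tr \<equiv> abs_trace p e"
definition h where "h = e div 2"

lemma e_eq: "2 * h = e" and even_h: "even h" and h_ge_2: "h \<ge> 2"
  using e_pos e_mod_4 unfolding h_def by presburger+

lemma p_ge_3: "p \<ge> 3"
  using prime_p odd_p prime_ge_2_nat[of p] by (cases "p = 2") auto

lemma CHAR_eq_p: "CHAR('a) = p"
proof -
  have "CHAR('a) dvd p ^ e"
    using CHAR_dvd_CARD[where ?'a = 'a] card_field by simp
  moreover have "prime CHAR('a)"
    by (intro prime_CHAR_semidom finite_imp_CHAR_pos) auto
  ultimately show ?thesis
    using prime_p by (metis prime_dvd_power primes_dvd_imp_eq)
qed

lemma prime_CHAR: "prime CHAR('a)"
  using CHAR_eq_p prime_p by simp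

lemma two_nonzero [simp]: "(2 :: 'a) \<noteq> 0"
proof
  assume "(2 :: 'a) = 0"
  then have "of_nat 2 = (0 :: 'a)" by simp
  then have "p dvd 2" using of_nat_eq_0_iff_char_dvd[where ?'a = 'a] CHAR_eq_p by metis
  then show False using p_ge_3 by (auto dest: dvd_imp_le)
qed

lemma four_nonzero [simp]: "(4 :: 'a) \<noteq> 0"
  using two_nonzero by (metis mult_2 mult_eq_0_iff numeral_Bit0)

lemma frob_add: "(x + y :: 'a) ^ (p ^ k) = x ^ (p ^ k) + y ^ (p ^ k)"
  using freshmans_dream'[OF prime_CHAR] CHAR_eq_p by blast

lemma frob_sum: "(\<Sum>i\<in>I. g i :: 'a) ^ (p ^ k) = (\<Sum>i\<in>I. g i ^ (p ^ k))"
  using freshmans_dream_sum'[OF prime_CHAR] CHAR_eq_p by blast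

lemma frob_minus: "(- x :: 'a) ^ (p ^ k) = - (x ^ (p ^ k))"
  using odd_p by simp

lemma frob_diff: "(x - y :: 'a) ^ (p ^ k) = x ^ (p ^ k) - y ^ (p ^ k)"
  using frob_add[of x "-y" k] frob_minus[of y k] by simp

text \<open>Multiplication by a nonzero \<open>x\<close> permutes the nonzero elements; comparing
  the products over them gives x^(q-1) = 1.\<close>

lemma power_q: "(x :: 'a) ^ (p ^ e) = x"
proof (cases "x = 0")
  case True
  then show ?thesis using prime_p by (simp add: prime_gt_0_nat)
next
  case False
  let ?U = "- {0 :: 'a}"
  have "bij_betw (\<lambda>y. x * y) ?U ?U"
    by (rule bij_betw_byWitness[where f' = "\<lambda>y. y / x"]) (use False in auto)
  then have "(\<Prod>y\<in>?U. x * y) = (\<Prod>y\<in>?U. y)"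
    by (rule prod.reindex_bij_betw)
  then have "x ^ card ?U * \<Prod>?U = \<Prod>?U"
    by (simp add: prod.distrib)
  moreover have "\<Prod>?U \<noteq> 0" by simp
  ultimately have "x ^ card ?U = 1" by simp
  moreover have "card ?U = p ^ e - 1"
    by (simp add: Compl_eq_Diff_UNIV card_Diff_subset card_field)
  moreover have "p ^ e = Suc (p ^ e - 1)" using prime_p by (simp add: prime_gt_0_nat)
  ultimately show ?thesis by (metis mult.right_neutral power_Suc)
qed

lemma of_nat_power_p: "(of_nat k :: 'a) ^ p = of_nat k"
proof (induction k)
  case 0
  then show ?case using p_ge_3 by simp
next
  case (Suc k)
  then show ?case using frob_add[of 1 "of_nat k" 1] by simp
qed

lemma card_image_of_nat: "card (of_nat ` {..<p} :: 'a set) = p"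
proof -
  have "inj_on (of_nat :: nat \<Rightarrow> 'a) {..<p}"
  proof (rule linorder_inj_onI)
    fix m n assume mn: "m < n" "m \<in> {..<p}" "n \<in> {..<p}"
    have "\<not> p dvd (n - m)" using mn by (auto dest!: dvd_imp_le)
    then show "(of_nat m :: 'a) \<noteq> of_nat n"
      using of_nat_eq_iff_char_dvd[OF mn(1), where ?'a = 'a] CHAR_eq_p by simp
  qed auto
  then show ?thesis by (simp add: card_image)
qed

lemma card_power_p_fixed_le: "card {x :: 'a. x ^ p = x} \<le> p"
proof (rule card_roots_le)
  let ?P = "monom 1 p - monom 1 1 :: 'a poly"
  show "coeff ?P p \<noteq> 0" using p_ge_3 by simp
  show "degree ?P \<le> p" using p_ge_3 by (intro degree_diff_le order.trans[OF degree_monom_le]) auto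
qed (auto simp: poly_monom)

text \<open>The residues 0, ..., p - 1 lie in \<open>Fp\<close>, which lies in the fixed set of the
  Frobenius map. The first set has \<open>p\<close> elements and the last at most \<open>p\<close>,
  as roots of X^p - X, so all three coincide.\<close>

lemma Fp_eq_image: "Fp = of_nat ` {..<p}" and Fp_iff: "x \<in> Fp \<longleftrightarrow> x ^ p = x"
proof -
  have sub: "of_nat ` {..<p} \<subseteq> Fp" "Fp \<subseteq> {x. x ^ p = x}"
    by (auto simp: prime_subfield_def of_nat_power_p)
  have "of_nat ` {..<p} = {x :: 'a. x ^ p = x}"
    using sub card_power_p_fixed_le by (intro card_seteq) (auto simp: card_image_of_nat)
  with sub show "Fp = of_nat ` {..<p}" "x \<in> Fp \<longleftrightarrow> x ^ p = x" by auto
qed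

lemma card_Fp [simp]: "card Fp = p"
  using Fp_eq_image card_image_of_nat by simp

lemma Fp_of_nat [simp, intro]: "of_nat k \<in> Fp"
  by (simp add: prime_subfield_def)

lemma Fp_closed [simp, intro]:
  "0 \<in> Fp" "1 \<in> Fp" "numeral n \<in> Fp"
  "x \<in> Fp \<Longrightarrow> y \<in> Fp \<Longrightarrow> x + y \<in> Fp"
  "x \<in> Fp \<Longrightarrow> y \<in> Fp \<Longrightarrow> x - y \<in> Fp"
  "x \<in> Fp \<Longrightarrow> y \<in> Fp \<Longrightarrow> x * y \<in> Fp"
  "x \<in> Fp \<Longrightarrow> y \<in> Fp \<Longrightarrow> x / y \<in> Fp"
  "x \<in> Fp \<Longrightarrow> x ^ k \<in> Fp"
  "x \<in> Fp \<Longrightarrow> - x \<in> Fp"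
proof -
  show "0 \<in> Fp" "1 \<in> Fp" "numeral n \<in> Fp"
    using Fp_of_nat[of 0] Fp_of_nat[of 1] Fp_of_nat[of "numeral n"] by simp_all
  show "x \<in> Fp \<Longrightarrow> y \<in> Fp \<Longrightarrow> x + y \<in> Fp"
    "x \<in> Fp \<Longrightarrow> y \<in> Fp \<Longrightarrow> x - y \<in> Fp"
    "x \<in> Fp \<Longrightarrow> y \<in> Fp \<Longrightarrow> x * y \<in> Fp"
    "x \<in> Fp \<Longrightarrow> y \<in> Fp \<Longrightarrow> x / y \<in> Fp"
    "x \<in> Fp \<Longrightarrow> - x \<in> Fp"
    using frob_add[of x y 1] frob_diff[of x y 1] frob_minus[of x 1]
    by (simp_all add: Fp_iff power_mult_distrib power_divide)
  show "x \<in> Fp \<Longrightarrow> x ^ k \<in> Fp"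
    by (simp add: Fp_iff flip: power_mult) (metis mult.commute power_mult)
qed

lemma Fp_frob: "x \<in> Fp \<Longrightarrow> x ^ (p ^ k) = x"
  by (induction k) (auto simp: Fp_iff power_mult)

lemma Tr_add: "Tr (x + y) = Tr x + Tr y"
  by (simp add: abs_trace_def frob_add sum.distrib)

lemma Tr_0 [simp]: "Tr 0 = 0"
  using Tr_add[of 0 0] by (metis add_cancel_right_right)

lemma Tr_minus: "Tr (- x) = - Tr x"
  using Tr_add[of x "- x"] by (simp add: eq_neg_iff_add_eq_0 add.commute)

lemma Tr_diff: "Tr (x - y) = Tr x - Tr y"
  using Tr_add[of x "- y"] by (simp add: Tr_minus)

lemma Tr_scale: "c \<in> Fp \<Longrightarrow> Tr (c * x) = c * Tr x"
  by (simp add: abs_trace_def power_mult_distrib Fp_frob sum_distrib_left)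

lemma Tr_of_Fp: "c \<in> Fp \<Longrightarrow> Tr c = of_nat e * c"
  by (simp add: abs_trace_def Fp_frob)

lemma Tr_frob1: "Tr (x ^ p) = Tr x"
proof -
  have "(\<Sum>j<e. (x ^ p) ^ (p ^ j)) = (\<Sum>j<e. x ^ (p ^ Suc j))"
    by (simp add: power_mult)
  also have "\<dots> = (\<Sum>j<Suc e. x ^ (p ^ j)) - x"
    by (subst sum.lessThan_Suc_shift) simp
  also have "\<dots> = (\<Sum>j<e. x ^ (p ^ j))"
    by (simp add: power_q)
  finally show ?thesis by (simp add: abs_trace_def)
qed

lemma Tr_frob: "Tr (x ^ (p ^ k)) = Tr x"
proof (induction k)
  case (Suc k)
  have "Tr (x ^ (p ^ Suc k)) = Tr ((x ^ (p ^ k)) ^ p)" by (simp add: power_mult mult.commute flip: power_mult)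
  then show ?case using Suc by (simp add: Tr_frob1)
qed simp

lemma Tr_in_Fp [simp, intro]: "Tr x \<in> Fp"
proof -
  have "Tr x ^ p = Tr (x ^ p)"
    using frob_sum[of "\<lambda>j. x ^ p ^ j" "{..<e}" 1]
    by (simp add: abs_trace_def flip: power_mult) (simp add: mult.commute)
  then show ?thesis by (simp add: Fp_iff Tr_frob1)
qed

text \<open>The degree bound for linearised polynomials: \<open>m = 1\<close> serves the trace,
  \<open>m = 2\<close> the maps \<open>lin\<close> and \<open>altsum\<close>.\<close>

lemma card_sum_power_roots_le:
  assumes "n > 0" "c (n - 1) \<noteq> 0" "m > 0"
  shows "card {x :: 'a. (\<Sum>j<n. c j * x ^ (p ^ (m * j))) = 0} \<le> p ^ (m * (n - 1))"
proof (rule card_roots_le)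
  let ?P = "\<Sum>j<n. monom (c j) (p ^ (m * j)) :: 'a poly"
  have "coeff ?P (p ^ (m * (n - 1))) = (\<Sum>j<n. if j = n - 1 then c j else 0)"
    unfolding coeff_sum using p_ge_3 assms by (intro sum.cong) auto
  also have "\<dots> = c (n - 1)" using assms by simp
  finally show "coeff ?P (p ^ (m * (n - 1))) \<noteq> 0" using assms by simp
  show "degree ?P \<le> p ^ (m * (n - 1))"
    using p_ge_3 by (intro degree_sum_le order.trans[OF degree_monom_le] power_increasing) auto
qed (auto simp: poly_sum poly_monom)

text \<open>The trace is a polynomial of degree p^(e-1) with values in \<open>Fp\<close>. As image
  size times kernel size is p^e, both bounds are attained.\<close>

lemma card_ker_Tr: "card {x. Tr x = 0} = p ^ (e - 1)" and range_Tr: "range Tr = Fp"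
proof -
  have le: "card {x. Tr x = 0} \<le> p ^ (e - 1)"
    using card_sum_power_roots_le[of e "\<lambda>_. 1" 1] e_pos by (simp add: abs_trace_def)
  have sub: "range Tr \<subseteq> Fp" by auto
  have le2: "card (range Tr) \<le> p" using card_mono[OF _ sub] by simp
  have eq: "p * p ^ (e - 1) = card (range Tr) * card {x. Tr x = 0}"
    using card_additive[of Tr, OF Tr_add] card_field e_pos by (simp flip: power_Suc)
  have pos: "p > 0" using p_ge_3 by simp
  show "card {x. Tr x = 0} = p ^ (e - 1)"
    using mult_eq_of_le[OF eq[symmetric] le2 le] pos by simp
  have "card (range Tr) = p"
    using mult_eq_of_le[OF eq[symmetric] le2 le] pos by simp
  then show "range Tr = Fp" using sub by (intro card_subset_eq) auto
qed

lemma card_Tr_mult: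
  assumes "a \<noteq> 0" "c \<in> Fp"
  shows "card {y. Tr (a * y) = c} = p ^ (e - 1)"
proof -
  have "bij_betw (\<lambda>y. a * y) {y. Tr (a * y) = c} {y. Tr y = c}"
    by (rule bij_betw_byWitness[where f' = "\<lambda>y. y / a"]) (use assms in auto)
  then have "card {y. Tr (a * y) = c} = card {y. Tr y = c}" by (rule bij_betw_same_card)
  also have "\<dots> = p ^ (e - 1)"
    using card_fibre_additive[of Tr c, OF Tr_add] assms range_Tr card_ker_Tr by simp
  finally show ?thesis .
qed

lemma Tr_nondegenerate:
  assumes "\<And>y. Tr (a * y) = 0"
  shows "a = 0"
proof (rule ccontr)
  assume "a \<noteq> 0"
  then have "card {y. Tr (a * y) = 1} = p ^ (e - 1)" by (intro card_Tr_mult) auto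
  then show False using assms p_ge_3 by simp
qed

section \<open>The quadratic character on the prime subfield\<close>

lemma qchar_of_int: "qchar (of_int k :: 'a) = Legendre k (int p)"
proof -
  have 0: "(of_int k :: 'a) = 0 \<longleftrightarrow> [k = 0] (mod int p)"
    using of_int_eq_0_iff_char_dvd[where ?'a = 'a, of k] CHAR_eq_p by (simp add: cong_0_iff)
  have "(\<exists>z\<in>Fp. (of_int k :: 'a) = z\<^sup>2) \<longleftrightarrow> QuadRes (int p) k"
  proof
    assume "\<exists>z\<in>Fp. (of_int k :: 'a) = z\<^sup>2"
    then obtain n where "(of_int k :: 'a) = (of_nat n)\<^sup>2" by (auto simp: prime_subfield_def)
    then have "of_int ((int n)\<^sup>2 - k) = (0 :: 'a)" by simp
    then show "QuadRes (int p) k" unfolding QuadRes_def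
      using of_int_eq_0_iff_char_dvd[where ?'a = 'a] CHAR_eq_p cong_iff_dvd_diff by blast
  next
    assume "QuadRes (int p) k"
    then obtain y where "[y\<^sup>2 = k] (mod int p)" by (auto simp: QuadRes_def)
    then have "of_int (y\<^sup>2 - k) = (0 :: 'a)"
      using of_int_eq_0_iff_char_dvd[where ?'a = 'a] CHAR_eq_p cong_iff_dvd_diff by metis
    then have "(of_int k :: 'a) = (of_int y)\<^sup>2" by simp
    moreover have "(of_int y :: 'a) \<in> Fp" by (cases y rule: int_cases2) auto
    ultimately show "\<exists>z\<in>Fp. (of_int k :: 'a) = z\<^sup>2" by blast
  qed
  then show ?thesis by (simp add: qchar_def Legendre_def 0)
qed

lemma of_int_qchar:
  assumes "x \<in> Fp"
  shows "of_int (qchar x) = x ^ ((p - 1) div 2)"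
proof -
  obtain k where k: "x = of_int (int k)" using assms by (auto simp: prime_subfield_def)
  have "[Legendre (int k) (int p) = int k ^ ((p - 1) div 2)] (mod int p)"
    using euler_criterion[of p "int k"] prime_p p_ge_3 by simp
  then have "of_int (Legendre (int k) (int p) - int k ^ ((p - 1) div 2)) = (0 :: 'a)"
    using of_int_eq_0_iff_char_dvd[where ?'a = 'a] CHAR_eq_p cong_iff_dvd_diff by metis
  then show ?thesis using qchar_of_int[of "int k"] by (simp add: k)
qed

lemma qchar_cases: "qchar x \<in> {-1, 0, 1}"
  by (simp add: qchar_def)

lemma qchar_eq_0_iff [simp]: "qchar x = 0 \<longleftrightarrow> x = 0"
  by (simp add: qchar_def)

lemma one_neq_minus_one: "(1 :: 'a) \<noteq> -1"
  using two_nonzero by (metis add_neg_numeral_special(7) add_right_cancel one_add_one)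

text \<open>By Euler's criterion the identity holds in the field. It lifts to the integers because
  -1, 0 and 1 stay distinct in odd characteristic.\<close>

lemma qchar_mult:
  assumes "x \<in> Fp" "y \<in> Fp"
  shows "qchar (x * y) = qchar x * qchar y"
proof -
  have "of_int (qchar (x * y)) = (of_int (qchar x * qchar y) :: 'a)"
    using assms by (simp add: of_int_qchar power_mult_distrib)
  moreover have "a = b" if "of_int a = (of_int b :: 'a)" "a \<in> {-1, 0, 1}" "b \<in> {-1, 0, 1}" for a b :: int
    using that one_neq_minus_one by auto
  moreover have "qchar x * qchar y \<in> {-1, 0, 1}"
    using qchar_cases[of x] qchar_cases[of y] by auto
  ultimately show ?thesis using qchar_cases by blast
qed

lemma qchar_square: "z \<in> Fp \<Longrightarrow> z \<noteq> 0 \<Longrightarrow> qchar (z\<^sup>2) = 1"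
  by (auto simp: qchar_def)

lemma qchar_mult_square: "x \<in> Fp \<Longrightarrow> z \<in> Fp \<Longrightarrow> z \<noteq> 0 \<Longrightarrow> qchar (z\<^sup>2 * x) = qchar x"
  by (simp add: qchar_mult qchar_square)

lemma card_square_roots:
  assumes "x \<in> Fp"
  shows "int (card {z \<in> Fp. z\<^sup>2 = x}) = 1 + qchar x"
proof (cases "\<exists>z\<in>Fp. x = z\<^sup>2")
  case False
  then have "{z \<in> Fp. z\<^sup>2 = x} = {}" by auto
  moreover have "x \<noteq> 0" using False Fp_closed(1) by (metis zero_power2)
  ultimately show ?thesis using False by (simp add: qchar_def)
next
  case True
  then obtain w where w: "w \<in> Fp" "x = w\<^sup>2" by auto
  have "{z \<in> Fp. z\<^sup>2 = x} = {w, -w}" using w by (auto simp: power2_eq_iff)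
  moreover have "w = -w \<longleftrightarrow> w = 0"
    using two_nonzero by (metis add.inverse_neutral eq_neg_iff_add_eq_0 mult_2 mult_eq_0_iff)
  ultimately show ?thesis using w by (auto simp: qchar_def card_insert_if)
qed

subsection \<open>Quadratic character sums\<close>

lemma bij_betw_Fp_affine:
  assumes "a \<in> Fp" "a \<noteq> 0" "b \<in> Fp"
  shows "bij_betw (\<lambda>r. a * r + b) Fp Fp"
  by (rule bij_betw_byWitness[where f' = "\<lambda>r. (r - b) / a"]) (use assms in auto)

lemma sum_Fp_squares:
  fixes g :: "'a \<Rightarrow> int"
  shows "(\<Sum>z\<in>Fp. g (z\<^sup>2)) = (\<Sum>y\<in>Fp. (1 + qchar y) * g y)"
proof -
  have "(\<Sum>z\<in>Fp. g (z\<^sup>2)) = (\<Sum>y\<in>Fp. \<Sum>z\<in>{z \<in> Fp. z\<^sup>2 = y}. g (z\<^sup>2))"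
    by (rule sum.group[symmetric]) auto
  also have "\<dots> = (\<Sum>y\<in>Fp. int (card {z \<in> Fp. z\<^sup>2 = y}) * g y)"
    by (intro sum.cong) auto
  also have "\<dots> = (\<Sum>y\<in>Fp. (1 + qchar y) * g y)"
    by (intro sum.cong) (simp_all add: card_square_roots)
  finally show ?thesis .
qed

lemma sum_qchar: "(\<Sum>x\<in>Fp. qchar x) = 0"
  using sum_Fp_squares[of "\<lambda>_. 1"] by (simp add: sum.distrib)

lemma sum_qchar_affine:
  assumes "a \<in> Fp" "a \<noteq> 0" "b \<in> Fp"
  shows "(\<Sum>r\<in>Fp. qchar (a * r + b)) = 0"
  using sum.reindex_bij_betw[OF bij_betw_Fp_affine[OF assms], of qchar] sum_qchar by simp

text \<open>For nonzero \<open>C\<close>, replace z^2 by \<open>y\<close> with weight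
  \<open>1 + qchar y\<close>. The part with weight 1 vanishes; since y (A y + C) = y^2 (A + C/y),
  the rest is the sum of \<open>qchar\<close> over all elements except \<open>A\<close>.\<close>

lemma sum_qchar_binomial:
  assumes A: "A \<in> Fp" "A \<noteq> 0" and C: "C \<in> Fp"
  shows "(\<Sum>z\<in>Fp. qchar (A * z\<^sup>2 + C)) = qchar A * ((if C = 0 then int p else 0) - 1)"
proof (cases "C = 0")
  case True
  have "(\<Sum>z\<in>Fp. qchar (A * z\<^sup>2 + C)) = (\<Sum>z\<in>Fp - {0}. qchar (A * z\<^sup>2))"
    using True by (intro sum.mono_neutral_cong_right) auto
  also have "\<dots> = (\<Sum>z\<in>Fp - {0}. qchar A)"
    using A by (intro sum.cong) (auto simp: mult.commute[of A] qchar_mult_square)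
  finally show ?thesis using True p_ge_3 by (simp add: card_Diff_subset of_nat_diff algebra_simps)
next
  case False
  have "(\<Sum>z\<in>Fp. qchar (A * z\<^sup>2 + C)) = (\<Sum>y\<in>Fp. (1 + qchar y) * qchar (A * y + C))"
    by (rule sum_Fp_squares)
  also have "\<dots> = (\<Sum>y\<in>Fp. qchar y * qchar (A * y + C))"
    using sum_qchar_affine[OF A C] by (simp add: ring_distribs sum.distrib)
  also have "\<dots> = (\<Sum>y\<in>Fp - {0}. qchar y * qchar (A * y + C))"
    by (intro sum.mono_neutral_right) auto
  also have "\<dots> = (\<Sum>y\<in>Fp - {0}. qchar (A + C / y))"
  proof (intro sum.cong refl)
    fix y assume y: "y \<in> Fp - {0}"
    have "qchar y * qchar (A * y + C) = qchar (y * (A * y + C))"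
      using y A C by (simp add: qchar_mult)
    also have "y * (A * y + C) = y\<^sup>2 * (A + C / y)"
      using y by (simp add: field_simps power2_eq_square)
    also have "qchar \<dots> = qchar (A + C / y)"
      using y A C by (intro qchar_mult_square) auto
    finally show "qchar y * qchar (A * y + C) = qchar (A + C / y)" .
  qed
  also have "\<dots> = (\<Sum>w\<in>Fp - {A}. qchar w)"
    by (rule sum.reindex_bij_witness[where i = "\<lambda>w. C / (w - A)" and j = "\<lambda>y. A + C / y"])
      (use A C False in auto)
  also have "\<dots> = - qchar A"
    using A sum_qchar by (simp add: sum_diff1)
  finally show ?thesis using False by simp
qed

lemma quadratic_complete_square:
  fixes A B C r :: 'a
  shows "4 * A * (A * r\<^sup>2 + B * r + C) = (2 * A * r + B)\<^sup>2 - (B\<^sup>2 - 4 * A * C)"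
  by (simp add: algebra_simps power2_eq_square)

lemma qchar_4_mult: "x \<in> Fp \<Longrightarrow> qchar (4 * x) = qchar x"
  using qchar_mult_square[of x 2] by simp

text \<open>Multiplying by 4A completes the square at the cost of a factor \<open>qchar A\<close>;
  an affine substitution then leaves a binomial sum.\<close>

lemma sum_qchar_quadratic:
  assumes A: "A \<in> Fp" "A \<noteq> 0" and B: "B \<in> Fp" and C: "C \<in> Fp"
  shows "(\<Sum>r\<in>Fp. qchar (A * r\<^sup>2 + B * r + C)) =
    qchar A * ((if B\<^sup>2 - 4 * A * C = 0 then int p else 0) - 1)"
proof -
  let ?D = "B\<^sup>2 - 4 * A * C"
  have "qchar (A * r\<^sup>2 + B * r + C) = qchar A * qchar (1 * (2 * A * r + B)\<^sup>2 + (- ?D))"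
    if r: "r \<in> Fp" for r
  proof -
    let ?X = "A * r\<^sup>2 + B * r + C"
    have "1 * (2 * A * r + B)\<^sup>2 + (- ?D) = 4 * (A * ?X)"
      using quadratic_complete_square[of A r B C] by (simp add: mult.assoc)
    then have "qchar A * qchar (1 * (2 * A * r + B)\<^sup>2 + (- ?D)) = qchar A * qchar (4 * (A * ?X))"
      by (simp only:)
    also have "qchar (4 * (A * ?X)) = qchar A * qchar ?X"
      using A B C r by (subst qchar_4_mult) (auto simp: qchar_mult)
    finally show ?thesis using A qchar_cases[of A] by auto
  qed
  then have "(\<Sum>r\<in>Fp. qchar (A * r\<^sup>2 + B * r + C))
      = qchar A * (\<Sum>r\<in>Fp. qchar (1 * (2 * A * r + B)\<^sup>2 + (- ?D)))"
    by (simp add: sum_distrib_left)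
  also have "(\<Sum>r\<in>Fp. qchar (1 * (2 * A * r + B)\<^sup>2 + (- ?D)))
      = (\<Sum>z\<in>Fp. qchar (1 * z\<^sup>2 + (- ?D)))"
    using A B by (intro sum.reindex_bij_betw bij_betw_Fp_affine) auto
  also have "\<dots> = (if - ?D = 0 then int p else 0) - 1"
    using A B C qchar_square[of 1] by (subst sum_qchar_binomial) auto
  finally show ?thesis by (simp only: neg_equal_0_iff_equal)
qed

lemma card_quadratic_roots:
  assumes A: "A \<in> Fp" "A \<noteq> 0" and B: "B \<in> Fp" and C: "C \<in> Fp"
  shows "int (card {r \<in> Fp. A * r\<^sup>2 + B * r + C = 0}) = 1 + qchar (B\<^sup>2 - 4 * A * C)"
proof -
  let ?D = "B\<^sup>2 - 4 * A * C"
  have eq: "A * r\<^sup>2 + B * r + C = 0 \<longleftrightarrow> (2 * A * r + B)\<^sup>2 = ?D" for r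
    using quadratic_complete_square[of A r B C] A
    by (metis (no_types, opaque_lifting) eq_iff_diff_eq_0 four_nonzero mult_eq_0_iff)
  have "bij_betw (\<lambda>r. 2 * A * r + B) {r \<in> Fp. A * r\<^sup>2 + B * r + C = 0} {z \<in> Fp. z\<^sup>2 = ?D}"
    by (rule bij_betw_byWitness[where f' = "\<lambda>z. (z - B) / (2 * A)"])
      (use A B C in \<open>auto simp: eq\<close>)
  then show ?thesis
    using A B C card_square_roots[of ?D] by (simp add: bij_betw_same_card)
qed

subsection \<open>The quadratic form and its radical\<close>

lemma p_power_e: "p ^ e = p\<^sup>2 * p ^ (e - 2)"
proof -
  have "e = 2 + (e - 2)" using e_eq h_ge_2 by simp
  then show ?thesis by (metis power_add)
qed

text \<open>For \<open>s = 1\<close> the kernel is the subfield of order p^2, for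
  \<open>s = -1\<close> it is the radical of the form \<open>Q\<close>. The parameter lets both be
  treated at once.\<close>

definition lin :: "'a \<Rightarrow> 'a \<Rightarrow> 'a" where
  "lin s x = x ^ (p ^ 2) - s * x"

text \<open>For \<open>s = 1\<close> this is the relative trace onto the subfield of order p^2, for
  \<open>s = -1\<close> its alternating variant.\<close>

definition altsum :: "'a \<Rightarrow> 'a \<Rightarrow> 'a" where
  "altsum s x = (\<Sum>j<h. s ^ j * x ^ (p ^ (2 * j)))"

lemma lin_add: "lin s (x + y) = lin s x + lin s y"
  by (simp add: lin_def frob_add algebra_simps)

lemma altsum_add: "altsum s (x + y) = altsum s x + altsum s y"
  by (simp add: altsum_def frob_add algebra_simps sum.distrib)

text \<open>Write f for the map x -> x^(p^2). Then \<open>lin s\<close> is f - s and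
  \<open>altsum s\<close> is the sum of (s f)^j, so either composite telescopes to s ((s f)^h - 1),
  which is zero.\<close>

lemma lin_altsum:
  assumes "s \<in> {1, -1}"
  shows "lin s (altsum s x) = 0" "altsum s (lin s x) = 0"
proof -
  define g where "g j = s ^ j * x ^ (p ^ (2 * j))" for j
  have s2: "s * s = 1" and sf: "\<And>j k. (s ^ j) ^ (p ^ k) = s ^ j"
    using assms odd_p by (auto simp flip: power_mult) (simp_all add: mult.commute[of _ "p ^ _"] power_mult)
  have g': "s ^ j * x ^ (p\<^sup>2 * p ^ (2 * j)) = s * g (Suc j)" for j
    using s2 by (simp add: g_def power2_eq_square mult.assoc flip: mult.assoc[of s s])
  have g: "g j ^ (p ^ 2) = s * g (Suc j)" for j
  proof -
    have "g j ^ (p ^ 2) = (s ^ j) ^ (p ^ 2) * (x ^ p ^ (2 * j)) ^ p ^ 2"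
      by (simp only: g_def power_mult_distrib)
    also have "\<dots> = s ^ j * x ^ (p\<^sup>2 * p ^ (2 * j))"
      unfolding sf by (simp only: power_mult[symmetric] mult.commute)
    finally show ?thesis by (simp only: g')
  qed
  have g'': "s ^ j * (x ^ p\<^sup>2) ^ p ^ (2 * j) = s * g (Suc j)" for j
    by (simp only: power_mult[symmetric] g')
  have tel: "(\<Sum>j<h. s * g (Suc j) - s * g j) = 0"
  proof -
    \<comment> \<open>This uses that 4 divides \<open>e\<close>: for odd \<open>h\<close> and
      \<open>s = -1\<close> the end terms of the telescope would not cancel.\<close>
    have "s ^ h = 1" using assms even_h by auto
    then have "g h = g 0" using power_q[of x] by (simp add: g_def e_eq)
    then show ?thesis using sum_lessThan_telescope[of "\<lambda>j. s * g j" h] by simp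
  qed
  have "lin s (altsum s x) = (\<Sum>j<h. g j ^ (p ^ 2)) - s * (\<Sum>j<h. g j)"
    by (simp add: lin_def altsum_def frob_sum g_def)
  then show "lin s (altsum s x) = 0"
    using tel by (simp add: g sum_subtractf sum_distrib_left)
  have "altsum s (lin s x) = (\<Sum>j<h. s ^ j * (x ^ (p ^ 2)) ^ (p ^ (2 * j)) - s ^ j * (s * x) ^ (p ^ (2 * j)))"
    by (simp add: lin_def altsum_def frob_diff algebra_simps)
  also have "\<dots> = (\<Sum>j<h. s * g (Suc j) - s * g j)"
    using sf[of 1] by (intro sum.cong refl) (simp only: g'', simp add: g_def power_mult_distrib)
  finally show "altsum s (lin s x) = 0" using tel by simp
qed

text \<open>The image of \<open>altsum s\<close> lies in the kernel of \<open>lin s\<close>, of size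
  at most p^2, and its own kernel has size at most p^(e-2). The image and kernel sizes multiply to
  p^e, so both bounds are sharp; the range of \<open>lin s\<close> then follows by counting.\<close>

lemma
  assumes s: "s \<in> {1, -1}"
  shows card_ker_lin: "card {x. lin s x = 0} = p\<^sup>2"
    and range_lin: "range (lin s) = {x. altsum s x = 0}"
proof -
  have le1: "card {x. lin s x = 0} \<le> p ^ 2"
  proof -
    let ?c = "\<lambda>j :: nat. if j = 0 then - s else 1"
    have "(\<Sum>j<2. ?c j * x ^ p ^ (2 * j)) = lin s x" for x
      by (simp add: lin_def lessThan_nat_numeral power2_eq_square)
    then show ?thesis using card_sum_power_roots_le[of 2 ?c 2] by simp
  qed
  have le2: "card {x. altsum s x = 0} \<le> p ^ (e - 2)"
  proof -
    have "2 * (h - 1) = e - 2" using e_eq by simp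
    then show ?thesis
      using card_sum_power_roots_le[of h "\<lambda>j. s ^ j" 2] h_ge_2 s by (auto simp: altsum_def)
  qed
  have sub: "range (altsum s) \<subseteq> {x. lin s x = 0}" and sub2: "range (lin s) \<subseteq> {x. altsum s x = 0}"
    using lin_altsum[OF s] by auto
  have le3: "card (range (altsum s)) \<le> p ^ 2"
    using card_mono[OF _ sub] le1 by simp
  note pe = p_power_e
  have pos: "p ^ 2 > 0" "p ^ (e - 2) > 0" using p_ge_3 by auto
  have "card (range (altsum s)) * card {x. altsum s x = 0} = p ^ 2 * p ^ (e - 2)"
    using card_additive[of "altsum s", OF altsum_add] card_field pe by simp
  note eqs = mult_eq_of_le[OF this le3 le2 pos]
  have ran: "range (altsum s) = {x. lin s x = 0}"
    using sub le1 eqs by (intro card_seteq) auto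
  then show ck: "card {x. lin s x = 0} = p\<^sup>2" using eqs by simp
  have "card (range (lin s)) * p ^ 2 = p ^ (e - 2) * p ^ 2"
    using card_additive[of "lin s", OF lin_add] card_field pe ck by (metis mult.commute)
  then have cr: "card (range (lin s)) = p ^ (e - 2)" using pos by simp
  show "range (lin s) = {x. altsum s x = 0}"
    using sub2 eqs cr by (intro card_seteq) auto
qed

definition Q :: "'a \<Rightarrow> 'a" where "Q x = Tr (x ^ (p + 1))"
text \<open>The polar form of \<open>Q\<close>, with its two cross terms collected in one trace so
  that the radical is visibly the kernel of \<open>lin (-1)\<close>.\<close>

definition B :: "'a \<Rightarrow> 'a \<Rightarrow> 'a" where "B x y = Tr (lin (-1) x * y ^ p)"
text \<open>The exponent p^(e-1) inverts the Frobenius map; it turns \<open>y ^ p\<close> in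
  \<open>B b y\<close> into \<open>y\<close>, so that \<open>adj b\<close> represents the functional
  \<open>B b\<close> through the trace form.\<close>

definition adj :: "'a \<Rightarrow> 'a" where "adj b = lin (-1) b ^ (p ^ (e - 1))"

abbreviation Rad :: "'a set" where "Rad \<equiv> {x. lin (-1) x = 0}"

lemma Q_in_Fp [simp, intro]: "Q x \<in> Fp" and B_in_Fp [simp, intro]: "B x y \<in> Fp"
  by (simp_all add: Q_def B_def)

lemma Q_add: "Q (x + y) = Q x + Q y + B x y"
proof -
  have "(x + y) ^ (p + 1) = (x ^ p + y ^ p) * (x + y)"
    using frob_add[of x y 1] by (simp add: mult.commute)
  also have "\<dots> = x ^ (p + 1) + y ^ (p + 1) + (x ^ p * y + x * y ^ p)"
    by (simp add: algebra_simps)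
  finally have "Q (x + y) = Q x + Q y + (Tr (x ^ p * y) + Tr (x * y ^ p))"
    by (simp only: Q_def Tr_add)
  \<comment> \<open>Applying Frobenius inside the trace gives both cross terms the common factor
    \<open>y ^ p\<close>.\<close>
  also have "Tr (x ^ p * y) = Tr (x ^ (p ^ 2) * y ^ p)"
    by (subst Tr_frob1[symmetric])
      (simp add: power_mult_distrib power2_eq_square flip: power_mult)
  also have "\<dots> + Tr (x * y ^ p) = B x y"
    by (simp add: B_def lin_def algebra_simps flip: Tr_add)
  finally show ?thesis .
qed

lemma B_sym: "B x y = B y x"
  using Q_add[of x y] Q_add[of y x] by (simp add: add_ac)

lemma B_add_right: "B x (y + z) = B x y + B x z"
  using frob_add[of y z 1] by (simp add: B_def algebra_simps Tr_add)

lemma B_scale_right: "c \<in> Fp \<Longrightarrow> B x (c * y) = c * B x y"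
  by (simp add: B_def power_mult_distrib Fp_iff mult.left_commute Tr_scale)

text \<open>Only the norm of \<open>c\<close> has to lie in F_p, so \<open>c\<close> may range over
  the whole subfield of order p^2.\<close>

lemma Q_scale: "c ^ (p + 1) \<in> Fp \<Longrightarrow> Q (c * x) = c ^ (p + 1) * Q x"
  unfolding Q_def by (simp only: power_mult_distrib Tr_scale)

lemma Q_scale_Fp: "c \<in> Fp \<Longrightarrow> Q (c * x) = c\<^sup>2 * Q x"
  using Q_scale[of c x] Fp_closed(6)[of c c] by (simp add: Fp_iff power2_eq_square)

lemma B_self: "B x x = 2 * Q x"
  using Q_add[of x x] Q_scale_Fp[of 2 x] by simp

lemma Q_0 [simp]: "Q 0 = 0"
  using Q_scale_Fp[of 0 0] by simp

lemma Rad_B: "x \<in> Rad \<Longrightarrow> B x y = 0" and Rad_B': "x \<in> Rad \<Longrightarrow> B y x = 0"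
  using B_sym[of y x] by (simp_all add: B_def)

lemma Rad_Q: "x \<in> Rad \<Longrightarrow> Q x = 0"
  using B_self[of x] Rad_B[of x x] by simp

lemma Tr_adj: "Tr (adj b * y) = B b y"
proof -
  have "(adj b * y) ^ p = lin (-1) b ^ (p ^ e) * y ^ p"
    using e_pos by (simp add: adj_def power_mult_distrib flip: power_mult power_Suc2)
  then show ?thesis using Tr_frob1[of "adj b * y"] by (simp add: B_def power_q)
qed

lemma adj_eq_0_iff: "adj b = 0 \<longleftrightarrow> b \<in> Rad"
  using p_ge_3 by (simp add: adj_def)

lemma adj_add: "adj (x + y) = adj x + adj y"
  by (simp add: adj_def lin_add frob_add)

lemma card_B:
  assumes "b \<notin> Rad" "c \<in> Fp"
  shows "card {y. B b y = c} = p ^ (e - 1)"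
  using card_Tr_mult[of "adj b" c] assms adj_eq_0_iff by (simp add: Tr_adj)

text \<open>The adjoint of \<^const>\<open>altsum\<close> with respect to the trace form is again \<^const>\<open>altsum\<close>, because
  \<open>h\<close> is even; hence the annihilator of \<open>Rad\<close> is the image of \<^const>\<open>lin\<close>.\<close>
lemma annihilator_Rad:
  assumes "\<And>x. x \<in> Rad \<Longrightarrow> Tr (a * x) = 0"
  shows "a \<in> range adj"
proof -
  have "Tr (altsum (-1) a * y) = 0" for y
  proof -
    have trm: "Tr ((-1) ^ (h - j) * a ^ (p ^ (2 * (h - j))) * y) = Tr ((-1) ^ j * (a * y ^ (p ^ (2 * j))))"
      if "j \<le> h" for j
    proof -
      have exps: "2 * (h - j) + 2 * j = e" using that e_eq by simp
      have "Tr ((-1) ^ (h - j) * a ^ (p ^ (2 * (h - j))) * y)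
          = Tr (((-1) ^ (h - j) * a ^ (p ^ (2 * (h - j))) * y) ^ (p ^ (2 * j)))"
        by (simp add: Tr_frob)
      also have "((-1) ^ (h - j) * a ^ (p ^ (2 * (h - j))) * y) ^ (p ^ (2 * j))
          = (-1) ^ j * (a ^ (p ^ e) * y ^ (p ^ (2 * j)))"
        using that odd_p even_h exps
        by (simp add: power_mult_distrib minus_one_power_iff flip: power_mult power_add)
      finally show ?thesis by (simp add: power_q)
    qed
    have "Tr (altsum (-1) a * y) = (\<Sum>j<h. Tr ((-1) ^ j * a ^ (p ^ (2 * j)) * y))"
      by (simp add: altsum_def sum_distrib_right abs_trace_def frob_sum sum.swap[of _ "{..<e}"])
    \<comment> \<open>The terms with index 0 and \<open>h\<close> agree, so the indices may be
      shifted to 1, ..., h; the reflection j -> h - j brings them back to 0, ..., h - 1.\<close>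
    also have "\<dots> = (\<Sum>j\<in>{..<h}. Tr ((-1) ^ Suc j * a ^ (p ^ (2 * Suc j)) * y))"
    proof -
      let ?g = "\<lambda>j. Tr ((-1) ^ j * a ^ (p ^ (2 * j)) * y)"
      have "?g h = ?g 0" using even_h power_q[of a] by (simp add: e_eq)
      then show ?thesis using sum.lessThan_Suc_shift[of ?g h] by simp
    qed
    also have "\<dots> = (\<Sum>j<h. Tr ((-1) ^ (h - j) * a ^ (p ^ (2 * (h - j))) * y))"
      by (rule sum.reindex_bij_witness[where i = "\<lambda>j. h - Suc j" and j = "\<lambda>j. h - Suc j"])
        (auto simp: Suc_diff_Suc)
    also have "\<dots> = (\<Sum>j<h. Tr ((-1) ^ j * (a * y ^ (p ^ (2 * j)))))"
      using trm by (intro sum.cong) auto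
    also have "\<dots> = Tr (a * altsum (-1) y)"
      by (simp add: altsum_def sum_distrib_left abs_trace_def frob_sum sum.swap[of _ "{..<e}"] mult.left_commute)
    also have "\<dots> = 0" using assms lin_altsum[of "-1" y] by simp
    finally show ?thesis .
  qed
  then have "altsum (-1) a = 0" by (rule Tr_nondegenerate)
  then have "a \<in> range (lin (-1))" using range_lin[of "-1"] by simp
  then obtain b where b: "a = lin (-1) b" by auto
  \<comment> \<open>\<open>adj\<close> contains an inverse Frobenius, so the preimage of
    \<open>a\<close> is \<open>b ^ p\<close> rather than \<open>b\<close>.\<close>
  have "adj (b ^ p) = (lin (-1) b ^ p) ^ (p ^ (e - 1))"
  proof -
    have "lin (-1) (b ^ p) = lin (-1) b ^ p"
      using frob_add[of "b ^ p\<^sup>2" b 1] by (simp add: lin_def mult.commute flip: power_mult)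
    then show ?thesis by (simp add: adj_def)
  qed
  also have "\<dots> = lin (-1) b"
    using e_pos power_q[of "lin (-1) b"] by (simp flip: power_mult power_Suc)
  finally show ?thesis using b by (metis rangeI)
qed

lemma card_range_adj: "card (range adj) = p ^ (e - 2)"
proof -
  have "p ^ e = card (range adj) * p\<^sup>2"
    using card_additive[of adj, OF adj_add] card_field card_ker_lin[of "-1"] by (simp add: adj_eq_0_iff)
  then show ?thesis using p_ge_3 p_power_e by simp
qed

section \<open>The norm from the subfield of order p^2\<close>

lemma norm_in_Fp: "lin 1 c = 0 \<Longrightarrow> c ^ (p + 1) \<in> Fp"
  by (simp add: lin_def Fp_iff power_mult_distrib mult.commute power2_eq_square flip: power_mult)

text \<open>The p^2 - 1 units of the subfield of order p^2 fall into norm fibres of size at most p +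
  1. If \<open>w\<close> were missed, p - 2 fibres would hold at most (p - 2)(p + 1) of them, which
  is too few.\<close>

lemma norm_surj:
  assumes w: "w \<in> Fp" "w \<noteq> 0"
  obtains c where "c \<noteq> 0" "c ^ (p + 1) = w"
proof -
  let ?U = "{c. lin 1 c = 0} - {0}"
  have "\<exists>c\<in>?U. c ^ (p + 1) = w"
  proof (rule ccontr)
    assume no: "\<not> ?thesis"
    have "0 \<in> {c. lin 1 c = 0}" using p_ge_3 by (simp add: lin_def)
    then have "p\<^sup>2 - 1 = card ?U" using card_ker_lin[of 1] by (simp add: card_Diff_singleton)
    also have "\<dots> = (\<Sum>v\<in>Fp - {0}. card {c \<in> ?U. c ^ (p + 1) = v})"
      using norm_in_Fp by (intro card_eq_sum_fibres) auto
    also have "\<dots> = (\<Sum>v\<in>Fp - {0, w}. card {c \<in> ?U. c ^ (p + 1) = v})"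
      using no by (intro sum.mono_neutral_right) auto
    also have "\<dots> \<le> (\<Sum>v\<in>Fp - {0, w}. p + 1)"
    proof (intro sum_mono)
      fix v
      show "card {c \<in> ?U. c ^ (p + 1) = v} \<le> p + 1"
      proof (rule card_roots_le)
        let ?P = "monom 1 (p + 1) - monom v 0 :: 'a poly"
        show "coeff ?P (p + 1) \<noteq> 0" by simp
        show "degree ?P \<le> p + 1" by (intro degree_diff_le order.trans[OF degree_monom_le]) auto
      qed (auto simp: poly_monom)
    qed
    also have "\<dots> = (p - 2) * (p + 1)"
      using w by (simp add: card_Diff_subset numeral_2_eq_2)
    finally have "p\<^sup>2 - 1 \<le> (p - 2) * (p + 1)" .
    moreover obtain k where "p = k + 3" using p_ge_3 by (metis add.commute le_Suc_ex)
    ultimately show False by (simp add: power2_eq_square algebra_simps)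
  qed
  then show ?thesis using that by auto
qed

subsection \<open>Level sets of the quadratic form\<close>

definition cardQ :: "'a \<Rightarrow> nat" where "cardQ w = card {y. Q y = w}"

text \<open>Multiplication by an element of norm \<open>w\<close> carries the level set of 1 onto
  that of \<open>w\<close>.\<close>

lemma cardQ_nonzero:
  assumes w: "w \<in> Fp" "w \<noteq> 0"
  shows "cardQ w = cardQ 1"
proof -
  obtain c where c: "c \<noteq> 0" "c ^ (p + 1) = w" using norm_surj[OF w] .
  have sc: "Q (c * y) = w * Q y" for y using Q_scale[of c y] c w by simp
  have sc': "Q (y / c) = Q y / w" for y using sc[of "y / c"] c w by (simp add: field_simps)
  have "bij_betw (\<lambda>y. c * y) {y. Q y = 1} {y. Q y = w}"
    by (rule bij_betw_byWitness[where f' = "\<lambda>y. y / c"]) (use c w in \<open>auto simp: sc sc'\<close>)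
  then show ?thesis by (simp add: cardQ_def bij_betw_same_card)
qed

lemma sum_cardQ_eq: "cardQ 0 + (p - 1) * cardQ 1 = p ^ e"
proof -
  have "p ^ e = (\<Sum>w\<in>Fp. card {y \<in> UNIV. Q y = w})"
    unfolding card_field[symmetric] by (rule card_eq_sum_fibres) auto
  also have "\<dots> = cardQ 0 + (\<Sum>w\<in>Fp - {0}. cardQ w)"
    by (simp add: cardQ_def sum.remove[of _ 0])
  also have "(\<Sum>w\<in>Fp - {0}. cardQ w) = (\<Sum>w\<in>Fp - {0}. cardQ 1)"
    by (intro sum.cong refl cardQ_nonzero) auto
  finally show ?thesis by (simp add: card_Diff_subset)
qed

text \<open>Both sides count the pairs with \<open>Q x = Q y\<close>. Substituting x = u + v, y = u
  - v turns the condition into \<open>B u v = 0\<close>, which holds for all \<open>v\<close> if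
  \<open>u\<close> is in the radical and for p^(e-1) of them otherwise.\<close>

lemma sum_cardQ_square:
  "(cardQ 0)\<^sup>2 + (p - 1) * (cardQ 1)\<^sup>2 = p\<^sup>2 * p ^ e + (p ^ e - p\<^sup>2) * p ^ (e - 1)"
proof -
  have "card (SIGMA x : UNIV. {y. Q y = Q x}) = (\<Sum>x\<in>UNIV. cardQ (Q x))"
    by (simp add: cardQ_def)
  also have "\<dots> = (\<Sum>w\<in>Fp. \<Sum>x\<in>{x \<in> UNIV. Q x = w}. cardQ (Q x))"
    by (rule sum.group[symmetric]) auto
  also have "\<dots> = (\<Sum>w\<in>Fp. (cardQ w)\<^sup>2)"
    by (intro sum.cong) (auto simp: cardQ_def power2_eq_square)
  also have "\<dots> = (cardQ 0)\<^sup>2 + (\<Sum>w\<in>Fp - {0}. (cardQ w)\<^sup>2)"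
    by (simp add: sum.remove[of _ 0])
  also have "(\<Sum>w\<in>Fp - {0}. (cardQ w)\<^sup>2) = (\<Sum>w\<in>Fp - {0}. (cardQ 1)\<^sup>2)"
    using cardQ_nonzero by (intro sum.cong refl) (metis DiffE insertI1)
  finally have 1: "card (SIGMA x : UNIV. {y. Q y = Q x}) = (cardQ 0)\<^sup>2 + (p - 1) * (cardQ 1)\<^sup>2"
    by (simp add: card_Diff_subset)
  have diff: "Q (u + v) = Q (u - v) \<longleftrightarrow> B u v = 0" for u v
  proof -
    have "Q (u - v) = Q u + Q v - B u v"
      using Q_add[of u "- v"] Q_scale_Fp[of "-1" v] B_scale_right[of "-1" u v] by simp
    then have "Q (u + v) - Q (u - v) = 2 * B u v" by (simp add: Q_add)
    then show ?thesis by (metis eq_iff_diff_eq_0 mult_eq_0_iff two_nonzero)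
  qed
  have half: "(x + y) / 2 + (x - y) / 2 = x" "(x + y) / 2 - (x - y) / 2 = y" for x y :: 'a
    by (simp_all flip: add_divide_distrib diff_divide_distrib)
  have "bij_betw (\<lambda>(u, v). (u + v, u - v)) (SIGMA u : UNIV. {v. B u v = 0}) (SIGMA x : UNIV. {y. Q y = Q x})"
    by (rule bij_betw_byWitness[where f' = "\<lambda>(x, y). ((x + y) / 2, (x - y) / 2)"])
      (use half in \<open>auto simp flip: diff\<close>)
  then have "card (SIGMA x : UNIV. {y. Q y = Q x}) = card (SIGMA u : UNIV. {v. B u v = 0})"
    by (simp add: bij_betw_same_card)
  also have "\<dots> = (\<Sum>u\<in>UNIV. card {v. B u v = 0})"
    by simp
  also have "\<dots> = (\<Sum>u\<in>Rad. card {v. B u v = 0}) + (\<Sum>u\<in>UNIV - Rad. card {v. B u v = 0})"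
    by (subst sum.subset_diff[of Rad]) (auto simp: add.commute)
  also have "(\<Sum>u\<in>Rad. card {v. B u v = 0}) = (\<Sum>u\<in>Rad. p ^ e)"
    using Rad_B by (intro sum.cong) (auto simp: card_field)
  also have "(\<Sum>u\<in>UNIV - Rad. card {v. B u v = 0}) = (\<Sum>u\<in>UNIV - Rad. p ^ (e - 1))"
    by (intro sum.cong refl card_B) auto
  finally show ?thesis using 1 card_ker_lin[of "-1"] by (simp add: card_Diff_subset card_field)
qed

text \<open>Elements of the subfield of order p^2 have norm in F_p, so its units act on the nonzero
  zeros of \<open>Q\<close>; every orbit has p^2 - 1 elements.\<close>

lemma Fp2_units_dvd_cardQ_0: "p\<^sup>2 - 1 dvd cardQ 0 - 1"
proof -
  let ?H = "{c. lin 1 c = 0} - {0}" and ?Z = "{y. Q y = 0} - {0}"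
  define orb where "orb z = (\<lambda>c. c * z) ` ?H" for z
  have fixed: "lin 1 c = 0 \<longleftrightarrow> c ^ (p\<^sup>2) = c" for c by (simp add: lin_def)
  have mult: "c * d \<in> ?H" "c / d \<in> ?H" if "c \<in> ?H" "d \<in> ?H" for c d
    using that by (auto simp: fixed power_mult_distrib power_divide)
  have one: "1 \<in> ?H" by (simp add: fixed)
  have "(p\<^sup>2 - 1) * card (orb ` ?Z) = card (\<Union> (orb ` ?Z))"
  proof (rule card_partition)
    fix c assume "c \<in> orb ` ?Z"
    then obtain z where z: "z \<noteq> 0" "c = orb z" by auto
    have "0 \<in> {c. lin 1 c = 0}" using p_ge_3 by (simp add: lin_def)
    then have "card ?H = p\<^sup>2 - 1" using card_ker_lin[of 1] by (simp add: card_Diff_singleton)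
    moreover have "inj_on (\<lambda>c. c * z) ?H" using z by (auto simp: inj_on_def)
    ultimately show "card c = p\<^sup>2 - 1" by (simp add: z orb_def card_image)
  next
    fix c1 c2 assume c: "c1 \<in> orb ` ?Z" "c2 \<in> orb ` ?Z" "c1 \<noteq> c2"
    show "c1 \<inter> c2 = {}"
    proof (rule ccontr)
      assume "c1 \<inter> c2 \<noteq> {}"
      then obtain z1 z2 a b where z: "c1 = orb z1" "c2 = orb z2" "a \<in> ?H" "b \<in> ?H" "a * z1 = b * z2"
        using c by (auto simp: orb_def)
      have sub: "orb x \<subseteq> orb y" if "a \<in> ?H" "b \<in> ?H" "a * x = b * y" for a b x y
      proof
        fix w assume "w \<in> orb x"
        then obtain c where c: "c \<in> ?H" "w = c * x" by (auto simp: orb_def)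
        have "x = b / a * y" using that by (auto simp: field_simps)
        then have "w = (c * (b / a)) * y" using c by simp
        moreover have "c * (b / a) \<in> ?H" using mult c that by blast
        ultimately show "w \<in> orb y" unfolding orb_def by blast
      qed
      have "c1 = c2" using sub[OF z(3,4,5)] sub[OF z(4,3) z(5)[symmetric]] z by auto
      then show False using c by simp
    qed
  qed auto
  moreover have "\<Union> (orb ` ?Z) = ?Z"
  proof
    show "\<Union> (orb ` ?Z) \<subseteq> ?Z"
    proof
      fix w assume "w \<in> \<Union> (orb ` ?Z)"
      then obtain z c where "z \<in> ?Z" "c \<in> ?H" "w = c * z" by (auto simp: orb_def)
      then show "w \<in> ?Z" using norm_in_Fp[of c] Q_scale[of c z] by auto
    qed
    show "?Z \<subseteq> \<Union> (orb ` ?Z)"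
      using one unfolding orb_def by (metis (no_types, lifting) UN_I image_eqI mult_1 subsetI)
  qed
  moreover have "card ?Z = cardQ 0 - 1" by (simp add: cardQ_def card_Diff_singleton)
  ultimately show ?thesis by (metis dvd_triv_left)
qed

text \<open>The square root of the field size. Real numbers make division by powers of
  \<open>p\<close> harmless in the closed formulas.\<close>

abbreviation K :: real where "K \<equiv> real p ^ h"

lemma power_p_diff: "k \<le> n \<Longrightarrow> real p ^ (n - k) = real p ^ n / real p ^ k"
  using p_ge_3 by (simp add: power_diff)

lemma power_p_e: "real p ^ e = K\<^sup>2"
  using power_mult[of "real p" h 2] e_eq by (simp add: mult.commute)

lemma e_ge_4: "e \<ge> 4"
  using e_eq h_ge_2 by simp

lemma power_p_mod: "[int p ^ (2 * k) = 1] (mod (int p)\<^sup>2 - 1)"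
  using cong_pow[of "(int p)\<^sup>2" 1 "(int p)\<^sup>2 - 1" k] by (simp add: power_mult cong_iff_dvd_diff)

text \<open>The first two moments of the level sizes give d^2 = p^2 q for the difference d. A
  positive d would force \<open>cardQ 0\<close> to be 2p - 1 modulo p^2 - 1, whereas the orbit count
  makes it 1.\<close>

lemma cardQ_diff: "int (cardQ 0) - int (cardQ 1) = - (int p ^ (h + 1))"
proof -
  define q f0 f1 d where "q = int p ^ e" and "f0 = int (cardQ 0)" and "f1 = int (cardQ 1)" and "d = f0 - f1"
  define P where "P = int p"
  have P3: "P \<ge> 3" using p_ge_3 by (simp add: P_def)
  have lin_eq: "f0 + (P - 1) * f1 = q"
    using arg_cong[OF sum_cardQ_eq, of int] p_ge_3 by (simp add: f0_def f1_def q_def P_def of_nat_diff)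
  have le: "p\<^sup>2 \<le> p ^ e" using e_ge_4 p_ge_3 by (intro power_increasing) auto
  have q: "q = P * P ^ (e - 1)" using e_pos by (simp add: q_def P_def flip: power_Suc)
  have "f0\<^sup>2 + (P - 1) * f1\<^sup>2 = P\<^sup>2 * q + (q - P\<^sup>2) * P ^ (e - 1)"
    using arg_cong[OF sum_cardQ_square, of int] p_ge_3 le
    by (simp add: f0_def f1_def q_def P_def of_nat_diff)
  then have "P * (f0\<^sup>2 + (P - 1) * f1\<^sup>2) = P * (P\<^sup>2 * q + (q - P\<^sup>2) * P ^ (e - 1))"
    by (simp only:)
  then have sq_eq: "P * (f0\<^sup>2 + (P - 1) * f1\<^sup>2) = P ^ 3 * q + (q - P\<^sup>2) * q"
    by (simp add: q algebra_simps power3_eq_cube power2_eq_square)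
  \<comment> \<open>A variance identity: the second moment splits into the squared first moment and
    a multiple of d^2.\<close>
  have "P * (f0\<^sup>2 + (P - 1) * f1\<^sup>2) = (f0 + (P - 1) * f1)\<^sup>2 + (P - 1) * d\<^sup>2"
    by (simp add: d_def algebra_simps power2_eq_square)
  then have "(P - 1) * d\<^sup>2 = (P - 1) * (P\<^sup>2 * q)"
    using sq_eq unfolding lin_eq by (simp add: algebra_simps power2_eq_square power3_eq_cube)
  then have "d\<^sup>2 = P\<^sup>2 * q" using P3 by simp
  also have "\<dots> = (P ^ (h + 1))\<^sup>2"
    using e_eq by (simp add: q_def P_def power_mult_distrib mult.commute flip: power_mult)
  finally have "d = P ^ (h + 1) \<or> d = - (P ^ (h + 1))" by (simp only: power2_eq_iff)
  moreover have "d \<noteq> P ^ (h + 1)"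
  proof
    assume d: "d = P ^ (h + 1)"
    have "P * f0 = q + (P - 1) * d" using lin_eq by (simp add: d_def algebra_simps)
    also have "\<dots> = P * (P ^ (e - 1) + (P - 1) * P ^ h)" by (simp add: q d algebra_simps)
    finally have f0: "f0 = P ^ (e - 1) + (P - 1) * P ^ h" using P3 by simp
    \<comment> \<open>Modulo p^2 - 1 only the parity of an exponent of p matters;
      \<open>e - 1\<close> is odd and \<open>h\<close> is even.\<close>
    have c1: "[P ^ (e - 1) = P] (mod P\<^sup>2 - 1)"
    proof -
      have "e - 1 = Suc (2 * (h - 1))" using e_eq h_ge_2 by linarith
      then have "P ^ (e - 1) = P * P ^ (2 * (h - 1))" by simp
      then show ?thesis using cong_mult[OF cong_refl power_p_mod[of "h - 1"], of P] by (simp add: P_def)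
    qed
    have c2: "[P ^ h = 1] (mod P\<^sup>2 - 1)"
      using power_p_mod[of "h div 2"] even_h by (simp add: P_def)
    have "[f0 = P + (P - 1) * 1] (mod P\<^sup>2 - 1)"
      unfolding f0 by (intro cong_add cong_mult c1 c2 cong_refl)
    moreover have "[f0 = 1] (mod P\<^sup>2 - 1)"
    proof -
      have "cardQ 0 \<ge> 1"
        unfolding cardQ_def using Q_0 by (metis (mono_tags, lifting) One_nat_def Suc_leI card_gt_0_iff empty_iff finite mem_Collect_eq)
      moreover have "p\<^sup>2 \<ge> 1" using p_ge_3 by simp
      ultimately have "P\<^sup>2 - 1 dvd f0 - 1"
        using Fp2_units_dvd_cardQ_0 of_nat_dvd_iff[where ?'a = int, of "p\<^sup>2 - 1" "cardQ 0 - 1"]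
        by (simp add: of_nat_diff P_def f0_def)
      then show ?thesis by (simp add: cong_iff_dvd_diff)
    qed
    ultimately have "[P + (P - 1) * 1 = 1] (mod P\<^sup>2 - 1)"
      using cong_sym cong_trans by blast
    moreover have "P + (P - 1) * 1 - 1 = 2 * (P - 1)" by simp
    ultimately have "P\<^sup>2 - 1 dvd 2 * (P - 1)" by (metis cong_iff_dvd_diff)
    then have "P\<^sup>2 - 1 \<le> 2 * (P - 1)" using P3 by (intro zdvd_imp_le) auto
    moreover have "P * P \<ge> 3 * P" using P3 by (intro mult_right_mono) auto
    ultimately show False using P3 by (simp add: power2_eq_square)
  qed
  ultimately show ?thesis by (simp add: d_def f0_def f1_def P_def)
qed

lemma cardQ_eq:
  assumes "w \<in> Fp"
  shows "real (cardQ w) = K\<^sup>2 / p + K - (if w = 0 then p * K else 0)"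
proof -
  have "of_int (int (cardQ 0) - int (cardQ 1)) = (of_int (- (int p ^ (h + 1))) :: real)"
    by (simp only: cardQ_diff)
  then have 1: "real (cardQ 0) - real (cardQ 1) = - (p * K)" by simp
  have 2: "real (cardQ 0) + (real p - 1) * real (cardQ 1) = K\<^sup>2"
    using arg_cong[OF sum_cardQ_eq, of real] p_ge_3 power_p_e by (simp add: of_nat_diff)
  have "p * real (cardQ 1) = K\<^sup>2 + p * K" using 1 2 by (simp add: algebra_simps)
  then have "real (cardQ 1) = K\<^sup>2 / p + K" using p_ge_3 by (simp add: field_simps)
  moreover have "real (cardQ w) = real (cardQ 1) - (if w = 0 then p * K else 0)"
    using 1 cardQ_nonzero[OF assms] by auto
  ultimately show ?thesis by simp
qed

text \<open>Every value pair \<open>(Q y, B b y)\<close> other than \<open>(u, v)\<close> lies on exactly one of the \<open>p + 1\<close> lines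
  through \<open>(u, v)\<close>, and the preimage of a line is a level set of \<open>B b\<close> or a translate of a level
  set of \<open>Q\<close>.\<close>
lemma card_Q_B_lines:
  assumes b: "b \<notin> Rad" and u: "u \<in> Fp" and v: "v \<in> Fp"
  shows "p * card {y. Q y = u \<and> B b y = v} + p ^ e =
    p ^ (e - 1) + (\<Sum>r\<in>Fp. cardQ (Q b * r\<^sup>2 + v * r + u))"
proof -
  have pt: "(\<Sum>r\<in>Fp. of_bool (Q y - u + r * (B b y - v) = 0)) + of_bool (B b y = v)
      = 1 + p * (of_bool (Q y = u \<and> B b y = v) :: nat)" for y
  proof (cases "B b y = v")
    case True
    then show ?thesis by simp
  next
    case False
    have "Q y - u + r * (B b y - v) = 0 \<longleftrightarrow> r = (u - Q y) / (B b y - v)" for r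
      using False by (simp add: field_simps)
    moreover have "(u - Q y) / (B b y - v) \<in> Fp" using u v by auto
    ultimately show ?thesis using False by (simp add: of_bool_def)
  qed
  have card_of_bool: "(\<Sum>y\<in>UNIV. of_bool (P y)) = card {y :: 'a. P y}" for P
    by (simp add: of_bool_def sum.If_cases)
  have shift: "card {y. Q y - u + r * (B b y - v) = 0} = cardQ (Q b * r\<^sup>2 + v * r + u)"
    if r: "r \<in> Fp" for r
  proof -
    \<comment> \<open>Translating by \<open>r * b\<close> absorbs the linear term
      \<open>r * B b y\<close> into \<open>Q\<close>.\<close>
    have Qs: "Q (y + r * b) = Q y + r * B b y + r\<^sup>2 * Q b" for y
      using r by (simp add: Q_add Q_scale_Fp B_scale_right B_sym[of y b])
    have iff: "Q y - u + r * (B b y - v) = 0 \<longleftrightarrow> Q (y + r * b) = Q b * r\<^sup>2 + v * r + u" for y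
      unfolding Qs by (auto simp: algebra_simps)
    have "bij_betw (\<lambda>y. y + r * b) {y. Q y - u + r * (B b y - v) = 0} {y. Q y = Q b * r\<^sup>2 + v * r + u}"
      by (rule bij_betw_byWitness[where f' = "\<lambda>y. y - r * b"]) (auto simp: iff)
    then show ?thesis by (simp add: cardQ_def bij_betw_same_card)
  qed
  have "p * card {y. Q y = u \<and> B b y = v} + p ^ e
      = (\<Sum>y\<in>UNIV. 1 + p * (of_bool (Q y = u \<and> B b y = v)))"
    by (simp only: sum.distrib sum_distrib_left[symmetric] card_of_bool sum_constant) (simp add: card_field)
  also have "\<dots> = (\<Sum>y\<in>UNIV. (\<Sum>r\<in>Fp. of_bool (Q y - u + r * (B b y - v) = 0)) + of_bool (B b y = v))"
    by (simp only: pt)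
  also have "\<dots> = (\<Sum>r\<in>Fp. card {y. Q y - u + r * (B b y - v) = 0}) + card {y. B b y = v}"
    by (simp only: sum.distrib sum.swap[of _ Fp UNIV] card_of_bool)
  also have "\<dots> = p ^ (e - 1) + (\<Sum>r\<in>Fp. cardQ (Q b * r\<^sup>2 + v * r + u))"
    using card_B[OF b v] by (simp add: shift)
  finally show ?thesis .
qed

text \<open>The level sizes of \<open>Q\<close> differ only at 0, so the sum over the lines through
  a point depends only on how often the quadratic polynomial in \<open>r\<close> vanishes.\<close>

lemma card_Q_B:
  assumes b: "b \<notin> Rad" and u: "u \<in> Fp" and v: "v \<in> Fp"
  shows "real (card {y. Q y = u \<and> B b y = v}) =
    K\<^sup>2 / p\<^sup>2 + K - K * card {r \<in> Fp. Q b * r\<^sup>2 + v * r + u = 0}"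
proof -
  let ?n = "card {r \<in> Fp. Q b * r\<^sup>2 + v * r + u = 0}"
  have "(\<Sum>r\<in>Fp. real (cardQ (Q b * r\<^sup>2 + v * r + u)))
      = (\<Sum>r\<in>Fp. K\<^sup>2 / p + K - (if Q b * r\<^sup>2 + v * r + u = 0 then p * K else 0))"
    using u v by (intro sum.cong refl cardQ_eq) auto
  also have "\<dots> = p * (K\<^sup>2 / p + K) - p * K * ?n"
    by (simp add: sum_subtractf sum.If_cases Int_def)
  finally have "real p * card {y. Q y = u \<and> B b y = v} + K\<^sup>2
      = K\<^sup>2 / p + (p * (K\<^sup>2 / p + K) - p * K * ?n)"
    using arg_cong[OF card_Q_B_lines[OF assms], of real] power_p_e power_p_diff[of 1 e] e_pos
    by simp
  then show ?thesis using p_ge_3 by (simp add: field_simps power2_eq_square)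
qed

text \<open>Twice the indicator of \<open>qchar x = 1\<close> equals 1 - [x = 0] +
  \<open>qchar x\<close>.\<close>

lemma card_qchar_eq_1:
  assumes "\<And>r. r \<in> Fp \<Longrightarrow> g r \<in> Fp"
  shows "2 * int (card {r \<in> Fp. qchar (g r :: 'a) = 1})
    = int p - int (card {r \<in> Fp. g r = 0}) + (\<Sum>r\<in>Fp. qchar (g r))"
proof -
  have "(\<Sum>r\<in>Fp. 2 * (if qchar (g r) = 1 then 1 else 0))
      = (\<Sum>r\<in>Fp. 1 - (if g r = 0 then 1 else 0) + qchar (g r))"
    using qchar_cases by (intro sum.cong refl) (force simp: qchar_def)
  then show ?thesis
    by (simp add: sum.distrib sum_subtractf sum.If_cases Int_def flip: sum_distrib_left)
qed

text \<open>The idea is to interpolate \<open>H\<close> by a polynomial of degree at most two in either argument.\<close>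
lemma sum_pairs_qchar:
  fixes H :: "int \<Rightarrow> int \<Rightarrow> real"
  shows "(\<Sum>T\<in>Fp. \<Sum>t\<in>Fp. H (qchar T) (qchar (t\<^sup>2 - T))) =
    H 0 0 + (real p - 1) * (H 0 1 + H 1 0) + (real p - 1) * (real p - 3) / 4 * H 1 1
    + (real p - 1)\<^sup>2 / 4 * (H 1 (-1) + H (-1) 1) + ((real p)\<^sup>2 - 1) / 4 * H (-1) (-1)"
proof -
  let ?a = "\<lambda>T :: 'a. real_of_int (qchar T)" and ?b = "\<lambda>T t :: 'a. real_of_int (qchar (t\<^sup>2 - T))"
  have zero: "(\<Sum>T\<in>Fp. ?a T) = 0" using sum_qchar by (simp flip: of_int_sum)
  have sq: "(?a x)\<^sup>2 = (if x = 0 then 0 else 1)" for x by (simp add: qchar_def)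
  have a2: "(\<Sum>T\<in>Fp. (?a T)\<^sup>2) = real p - 1"
  proof -
    have "Fp \<inter> - {0} = Fp - {0}" by auto
    then show ?thesis using p_ge_3 by (simp add: sq sum.If_cases of_nat_diff card_Diff_subset)
  qed
  have b1: "(\<Sum>t\<in>Fp. ?b T t) = (if T = 0 then real p else 0) - 1" if "T \<in> Fp" for T
    using arg_cong[OF sum_qchar_binomial[of 1 "- T"], of real_of_int] that qchar_square[of 1] by simp
  have b2: "(\<Sum>t\<in>Fp. (?b T t)\<^sup>2) = real p - 1 - ?a T" if "T \<in> Fp" for T
  proof -
    have "(\<Sum>t\<in>Fp. (?b T t)\<^sup>2) = (\<Sum>t\<in>Fp. 1 - (if t\<^sup>2 = T then 1 else 0))"
      by (intro sum.cong) (simp_all add: sq)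
    also have "\<dots> = real p - real_of_int (int (card {t \<in> Fp. t\<^sup>2 = T}))"
      by (simp add: sum_subtractf sum.If_cases Int_def)
    finally show ?thesis using card_square_roots[OF that] by simp
  qed
  \<comment> \<open>\<open>c x g\<close> is the coefficient of degree \<open>x\<close> of the
    quadratic agreeing with \<open>g\<close> at -1, 0 and 1. Accordingly \<open>k i j\<close> is the
    coefficient of degree \<open>i\<close> in the first and \<open>j\<close> in the second argument
    of \<open>H\<close>.\<close>
  define c where "c x = (\<lambda>g :: int \<Rightarrow> real. [g 0, (g 1 - g (-1)) / 2, (g 1 + g (-1)) / 2 - g 0] ! x)" for x :: nat
  define k where "k i j = c i (\<lambda>x. c j (H x))" for i j
  have interp: "H x y = k 0 0 + k 1 0 * x + k 2 0 * (real_of_int x)\<^sup>2 + (k 0 1 + k 1 1 * x + k 2 1 * (real_of_int x)\<^sup>2) * y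
      + (k 0 2 + k 1 2 * x + k 2 2 * (real_of_int x)\<^sup>2) * (real_of_int y)\<^sup>2"
    if "x \<in> {-1, 0, 1}" "y \<in> {-1, 0, 1}" for x y
    using that by (auto simp: k_def c_def numeral_2_eq_2) (simp_all add: field_simps)
  have inner: "(\<Sum>t\<in>Fp. H (qchar T) (qchar (t\<^sup>2 - T))) =
      p * (k 0 0 + k 1 0 * ?a T + k 2 0 * (?a T)\<^sup>2)
      + (k 0 1 + k 1 1 * ?a T + k 2 1 * (?a T)\<^sup>2) * (p * (1 - (?a T)\<^sup>2) - 1)
      + (k 0 2 + k 1 2 * ?a T + k 2 2 * (?a T)\<^sup>2) * (real p - 1 - ?a T)" if T: "T \<in> Fp" for T
  proof -
    have "(\<Sum>t\<in>Fp. H (qchar T) (qchar (t\<^sup>2 - T))) = (\<Sum>t\<in>Fp. k 0 0 + k 1 0 * ?a T + k 2 0 * (?a T)\<^sup>2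
      + (k 0 1 + k 1 1 * ?a T + k 2 1 * (?a T)\<^sup>2) * ?b T t
      + (k 0 2 + k 1 2 * ?a T + k 2 2 * (?a T)\<^sup>2) * (?b T t)\<^sup>2)"
      by (intro sum.cong refl interp qchar_cases)
    also have "\<dots> = p * (k 0 0 + k 1 0 * ?a T + k 2 0 * (?a T)\<^sup>2)
      + (k 0 1 + k 1 1 * ?a T + k 2 1 * (?a T)\<^sup>2) * (\<Sum>t\<in>Fp. ?b T t)
      + (k 0 2 + k 1 2 * ?a T + k 2 2 * (?a T)\<^sup>2) * (\<Sum>t\<in>Fp. (?b T t)\<^sup>2)"
      by (simp add: sum.distrib sum_distrib_left)
    finally show ?thesis using b1[OF T] b2[OF T] sq[of T] by simp
  qed
  \<comment> \<open>Character values satisfy a^3 = a, so the inner sum reduces to a quadratic in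
    \<open>?a T\<close>, which \<open>zero\<close> and \<open>a2\<close> suffice to sum.\<close>
  have "(\<Sum>T\<in>Fp. \<Sum>t\<in>Fp. H (qchar T) (qchar (t\<^sup>2 - T))) = (\<Sum>T\<in>Fp.
      (p * k 0 0 + (real p - 1) * (k 0 1 + k 0 2))
      + (p * k 1 0 - k 1 1 + (real p - 1) * k 1 2 - k 0 2 - k 2 2) * ?a T
      + (p * k 2 0 - p * k 0 1 - k 2 1 + (real p - 1) * k 2 2 - k 1 2) * (?a T)\<^sup>2)"
  proof (intro sum.cong refl)
    fix T assume T: "T \<in> Fp"
    have at: "?a T = 0 \<or> ?a T = 1 \<or> ?a T = -1" using qchar_cases[of T] by auto
    have "a = 0 \<or> a = 1 \<or> a = -1 \<Longrightarrow>
      p * (k 0 0 + k 1 0 * a + k 2 0 * a\<^sup>2)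
      + (k 0 1 + k 1 1 * a + k 2 1 * a\<^sup>2) * (p * (1 - a\<^sup>2) - 1)
      + (k 0 2 + k 1 2 * a + k 2 2 * a\<^sup>2) * (real p - 1 - a) =
      (p * k 0 0 + (real p - 1) * (k 0 1 + k 0 2))
      + (p * k 1 0 - k 1 1 + (real p - 1) * k 1 2 - k 0 2 - k 2 2) * a
      + (p * k 2 0 - p * k 0 1 - k 2 1 + (real p - 1) * k 2 2 - k 1 2) * a\<^sup>2" for a :: real
      by (elim disjE) (simp_all add: algebra_simps)
    then show "(\<Sum>t\<in>Fp. H (qchar T) (qchar (t\<^sup>2 - T))) =
      (p * k 0 0 + (real p - 1) * (k 0 1 + k 0 2))
      + (p * k 1 0 - k 1 1 + (real p - 1) * k 1 2 - k 0 2 - k 2 2) * ?a T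
      + (p * k 2 0 - p * k 0 1 - k 2 1 + (real p - 1) * k 2 2 - k 1 2) * (?a T)\<^sup>2"
      unfolding inner[OF T] using at by blast
  qed
  also have "\<dots> = p * (p * k 0 0 + (real p - 1) * (k 0 1 + k 0 2))
      + (p * k 2 0 - p * k 0 1 - k 2 1 + (real p - 1) * k 2 2 - k 1 2) * (real p - 1)"
    by (simp only: sum.distrib sum_distrib_left[symmetric] zero a2 sum_constant card_Fp) (simp add: algebra_simps)
  also have "\<dots> = H 0 0 + (real p - 1) * (H 0 1 + H 1 0) + (real p - 1) * (real p - 3) / 4 * H 1 1
    + (real p - 1)\<^sup>2 / 4 * (H 1 (-1) + H (-1) 1) + ((real p)\<^sup>2 - 1) / 4 * H (-1) (-1)"
    by (simp add: k_def c_def numeral_2_eq_2) (simp add: field_simps power2_eq_square)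
  finally show ?thesis .
qed

end

subsection \<open>The code\<close>

locale trace_code = trace_field +
  fixes i :: nat
  assumes i_01: "i \<in> {0, 1}" and Legendre_e: "Legendre (int e) (int p) = (-1) ^ i"
begin

text \<open>The value of \<open>Q\<close> at 1/2, that is, the constant split off when the square is
  completed.\<close>

definition \<gamma> :: 'a where "\<gamma> = of_nat e / 4"

abbreviation half :: 'a where "half \<equiv> 1 / 2"

abbreviation eps :: int where "eps \<equiv> Legendre (-1) (int p)"

text \<open>The values of \<open>Q (x - half)\<close> on the defining set. The index
  \<open>i\<close> is chosen so that \<gamma> has character (-1)^i; multiplying by \<gamma>
  therefore removes \<open>i\<close> from the condition.\<close>

definition S :: "'a set" where "S = {u \<in> Fp. qchar (\<gamma> * (u - \<gamma>)) = 1}"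

abbreviation D :: "'a set" where "D \<equiv> defset p e i"

definition wt :: "'a \<Rightarrow> nat" where "wt a = card {x \<in> D. Tr (a * x) \<noteq> 0}"

lemma gamma_in_Fp [simp, intro]: "\<gamma> \<in> Fp"
  unfolding \<gamma>_def by (intro Fp_closed Fp_of_nat)

lemma qchar_gamma: "qchar \<gamma> = (-1) ^ i"
proof -
  have "qchar \<gamma> = qchar (4 * \<gamma>)" by (simp add: qchar_4_mult)
  also have "4 * \<gamma> = of_int (int e)" by (simp add: \<gamma>_def)
  finally show ?thesis using qchar_of_int[of "int e"] Legendre_e by simp
qed

lemma gamma_nonzero [simp]: "\<gamma> \<noteq> 0"
  using qchar_gamma by (metis qchar_eq_0_iff power_not_zero neg_equal_0_iff_equal one_neq_zero)

lemma half_in_Fp [simp, intro]: "half \<in> Fp"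
  by (intro Fp_closed)

lemma Q_half: "Q half = \<gamma>"
proof -
  have "half ^ p = half" using half_in_Fp Fp_iff by blast
  then have "half ^ (p + 1) = half * half" by (simp only: power_add power_one_right)
  also have "\<dots> = 1 / 4" by simp
  finally have "half ^ (p + 1) = 1 / 4" .
  then have "Q half = Tr (1 / 4)" by (simp only: Q_def)
  also have "\<dots> = of_nat e * (1 / 4)" by (intro Tr_of_Fp Fp_closed)
  finally show ?thesis by (simp add: \<gamma>_def)
qed

text \<open>Identifies the linear term of the defining function with the polar form at 1/2, as
  needed to complete the square.\<close>

lemma B_half: "B x half = Tr x"
proof -
  have "half ^ p = half" using half_in_Fp Fp_iff by blast
  then have "B x half = Tr ((x ^ (p ^ 2) - (-1) * x) * half)"
    by (simp only: B_def lin_def)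
  also have "\<dots> = Tr (half * (x ^ (p ^ 2) + x))"
    by simp
  also have "\<dots> = half * (Tr (x ^ (p ^ 2)) + Tr x)"
    using half_in_Fp by (simp only: Tr_scale Tr_add)
  finally show ?thesis by (simp add: Tr_frob)
qed

lemma half_notin_Rad: "half \<notin> Rad"
  using Rad_Q[of half] Q_half by auto

lemma Tr_norm_diff: "Tr (x ^ (p + 1) - x) = Q (x - half) - \<gamma>"
proof -
  have "Q (x + (-1) * half) = Q x + (-1)\<^sup>2 * Q half + (-1) * B x half"
    by (subst Q_add, subst Q_scale_Fp, simp, subst B_scale_right) simp_all
  then have "Q (x - half) = Q x + \<gamma> - Tr x" by (simp add: Q_half B_half)
  then show ?thesis by (simp add: Tr_diff Q_def)
qed

lemma cyc2_iff: "y \<in> cyc2 i \<longleftrightarrow> y \<in> Fp \<and> qchar y = (-1) ^ i"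
  using i_01 by (auto simp: cyc2_def qchar_def)

lemma defset_iff: "x \<in> D \<longleftrightarrow> Q (x - half) \<in> S"
proof -
  have "x \<in> D \<longleftrightarrow> qchar (Q (x - half) - \<gamma>) = (-1) ^ i"
    unfolding defset_def mem_Collect_eq Tr_norm_diff cyc2_iff by auto
  also have "\<dots> \<longleftrightarrow> qchar (\<gamma> * (Q (x - half) - \<gamma>)) = 1"
    using i_01 by (auto simp: qchar_mult qchar_gamma)
  finally show ?thesis by (simp add: S_def)
qed

lemma card_S: "2 * real (card S) = real p - 1"
proof -
  have aff: "\<gamma> * (u - \<gamma>) = \<gamma> * u + (- \<gamma>\<^sup>2)" for u by (simp add: algebra_simps power2_eq_square)
  have "{r \<in> Fp. \<gamma> * r + - \<gamma>\<^sup>2 = 0} = {\<gamma>}"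
    by (auto simp: power2_eq_square simp flip: eq_iff_diff_eq_0)
  then have "2 * int (card S) = int p - 1"
    using card_qchar_eq_1[of "\<lambda>u. \<gamma> * u + (- \<gamma>\<^sup>2)"] sum_qchar_affine[of \<gamma> "- \<gamma>\<^sup>2"]
    unfolding S_def aff by simp
  then show ?thesis by linarith
qed

lemma qchar_minus_one [simp]: "qchar (-1 :: 'a) = eps"
  using qchar_of_int[of "-1"] by simp

lemma eps_cases: "eps = 1 \<or> eps = -1"
  using qchar_cases[of "-1 :: 'a"] qchar_eq_0_iff[of "-1 :: 'a"] by auto

text \<open>The two residue classes of \<open>p\<close> modulo 4 separate here: the exceptional
  level 0 of \<open>Q\<close> contributes to the defining set only if -1 is a square.\<close>

lemma zero_in_S_iff: "0 \<in> S \<longleftrightarrow> eps = 1"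
proof -
  have "qchar (\<gamma> * (0 - \<gamma>)) = qchar (\<gamma>\<^sup>2 * (-1))" by (simp add: power2_eq_square)
  also have "\<dots> = qchar (-1 :: 'a)" by (rule qchar_mult_square) auto
  finally show ?thesis by (simp add: S_def)
qed

lemma finite_S [simp]: "finite S" and S_sub: "S \<subseteq> Fp"
  by (auto simp: S_def)

lemma card_D: "real (card D) = (real p - 1) / 2 * (K\<^sup>2 / p) - (1 + eps * p) / 2 * K"
proof -
  have "bij_betw (\<lambda>x. x - half) D {y. Q y \<in> S}"
    by (rule bij_betw_byWitness[where f' = "\<lambda>y. y + half"]) (auto simp: defset_iff)
  then have "card D = card {y. Q y \<in> S}" by (rule bij_betw_same_card)
  also have "\<dots> = (\<Sum>u\<in>S. card {y \<in> {y. Q y \<in> S}. Q y = u})"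
    by (rule card_eq_sum_fibres) auto
  also have "\<dots> = (\<Sum>u\<in>S. cardQ u)"
    unfolding cardQ_def by (intro sum.cong refl arg_cong[where f = card]) auto
  finally have "real (card D) = (\<Sum>u\<in>S. real (cardQ u))" by simp
  also have "\<dots> = (\<Sum>u\<in>S. K\<^sup>2 / p + K - (if u = 0 then p * K else 0))"
    using S_sub by (intro sum.cong refl cardQ_eq) auto
  also have "\<dots> = card S * (K\<^sup>2 / p + K) - (if eps = 1 then p * K else 0)"
    by (simp add: sum_subtractf zero_in_S_iff)
  also have "real (card S) = (real p - 1) / 2" using card_S by simp
  finally have "real (card D) = (real p - 1) / 2 * (K\<^sup>2 / p + K) - (if eps = 1 then p * K else 0)" .
  then show ?thesis using eps_cases by (elim disjE) (simp_all add: ring_distribs diff_divide_distrib add_divide_distrib)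
qed

section \<open>Weights of single codewords\<close>

lemma wt_eq: "real (wt a) = real (card D) - real (card {x \<in> D. Tr (a * x) = 0})"
proof -
  have "D = {x \<in> D. Tr (a * x) \<noteq> 0} \<union> {x \<in> D. Tr (a * x) = 0}" by auto
  then have "card D = wt a + card {x \<in> D. Tr (a * x) = 0}"
    unfolding wt_def by (subst (1) \<open>D = _\<close>, subst card_Un_disjoint) auto
  then show ?thesis by simp
qed

lemma lin_scale_Fp: "c \<in> Fp \<Longrightarrow> lin s (c * x) = c * lin s x"
  by (simp add: lin_def power_mult_distrib Fp_frob algebra_simps)

text \<open>Some radical vector \<open>x\<close> has \<open>Tr (a * x)\<close> nonzero. Translations
  by its F_p-multiples preserve \<open>Q\<close>, hence the defining set, and shift
  \<open>Tr (a * y)\<close> by any prescribed constant, so all values are equally frequent.\<close>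

lemma wt_notin_range_adj:
  assumes "a \<notin> range adj"
  shows "real (wt a) = (real p - 1) / p * card D"
proof -
  obtain x where x: "x \<in> Rad" "Tr (a * x) \<noteq> 0" using annihilator_Rad assms by blast
  have fib: "card {y \<in> D. Tr (a * y) = c} = card {y \<in> D. Tr (a * y) = 0}" if c: "c \<in> Fp" for c
  proof -
    define z where "z = c / Tr (a * x) * x"
    have k: "c / Tr (a * x) \<in> Fp" using c by auto
    have z: "z \<in> Rad" using x k by (simp add: z_def lin_scale_Fp del: times_divide_eq_left)
    have "Tr (a * z) = Tr (c / Tr (a * x) * (a * x))" by (simp add: z_def mult_ac)
    also have "\<dots> = c" unfolding Tr_scale[OF k] using x by simp
    finally have Tz: "Tr (a * z) = c" .
    have Q1: "Q (y + z) = Q y" for y using z Rad_Q Rad_B' by (simp add: Q_add)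
    have D1: "y + z \<in> D \<longleftrightarrow> y \<in> D" for y
      using Q1[of "y - half"] by (simp add: defset_iff algebra_simps)
    have D2: "y - z \<in> D \<longleftrightarrow> y \<in> D" for y using D1[of "y - z"] by simp
    have "bij_betw (\<lambda>y. y + z) {y \<in> D. Tr (a * y) = 0} {y \<in> D. Tr (a * y) = c}"
      by (rule bij_betw_byWitness[where f' = "\<lambda>y. y - z"])
        (auto simp: D1 D2 ring_distribs right_diff_distrib Tr_add Tr_diff Tz)
    then show ?thesis by (simp add: bij_betw_same_card)
  qed
  have "card D = (\<Sum>c\<in>Fp. card {y \<in> D. Tr (a * y) = c})"
    by (rule card_eq_sum_fibres) auto
  also have "\<dots> = (\<Sum>c\<in>Fp. card {y \<in> D. Tr (a * y) = 0})"
    by (intro sum.cong refl fib)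
  finally have "real (card D) = p * real (card {y \<in> D. Tr (a * y) = 0})" by simp
  then show ?thesis using p_ge_3 by (simp add: wt_eq field_simps)
qed

text \<open>Twice the number of parameters \<open>r\<close> counted in
  \<open>card_conic_points\<close>, as a function of two characters; doubling keeps it an integer
  expression.\<close>

definition M2 :: "int \<Rightarrow> int \<Rightarrow> int" where
  "M2 \<alpha> \<beta> = (if \<alpha> = 0 then (if \<beta> = 0 then p + p * eps else int p - 1)
     else int p - 1 - \<beta> + eps * \<alpha> * ((if \<beta> = 0 then int p else 0) - 1))"

text \<open>The condition says that a quadratic in \<open>r\<close> takes a nonzero square value;
  its discriminant is \<gamma>^2 (s^2 - 4 \<gamma> t). Its root count and character sum give the
  answer, and for \<open>t = 0\<close> it degenerates to a linear or constant function.\<close>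

lemma card_conic_points:
  assumes t: "t \<in> Fp" and s: "s \<in> Fp"
  shows "2 * int (card {r \<in> Fp. - (t * r\<^sup>2 - s * r) \<in> S}) = M2 (qchar (\<gamma> * t)) (qchar (s\<^sup>2 - 4 * \<gamma> * t))"
proof -
  let ?g = "\<lambda>r. (- (\<gamma> * t)) * r\<^sup>2 + (\<gamma> * s) * r + (- \<gamma>\<^sup>2)"
  have cl: "- (\<gamma> * t) \<in> Fp" "\<gamma> * s \<in> Fp" "- \<gamma>\<^sup>2 \<in> Fp" using t s by auto
  have g: "\<gamma> * (- (t * r\<^sup>2 - s * r) - \<gamma>) = ?g r" for r
    by (simp add: algebra_simps power2_eq_square)
  have "{r \<in> Fp. - (t * r\<^sup>2 - s * r) \<in> S} = {r \<in> Fp. qchar (?g r) = 1}"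
    unfolding S_def mem_Collect_eq g using t s by auto
  moreover have "2 * int (card {r \<in> Fp. qchar (?g r) = 1})
      = int p - int (card {r \<in> Fp. ?g r = 0}) + (\<Sum>r\<in>Fp. qchar (?g r))"
    by (intro card_qchar_eq_1 Fp_closed cl)
  moreover have "\<dots> = M2 (qchar (\<gamma> * t)) (qchar (s\<^sup>2 - 4 * \<gamma> * t))"
  proof (cases "t = 0")
    case False
    have disc: "(\<gamma> * s)\<^sup>2 - 4 * (- (\<gamma> * t)) * (- \<gamma>\<^sup>2) = \<gamma>\<^sup>2 * (s\<^sup>2 - 4 * \<gamma> * t)"
      by (simp add: algebra_simps power2_eq_square)
    have q: "qchar (\<gamma>\<^sup>2 * (s\<^sup>2 - 4 * \<gamma> * t)) = qchar (s\<^sup>2 - 4 * \<gamma> * t)"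
      using t s by (intro qchar_mult_square) auto
    have "int (card {r \<in> Fp. ?g r = 0}) = 1 + qchar (s\<^sup>2 - 4 * \<gamma> * t)"
      using card_quadratic_roots[OF cl(1) _ cl(2,3)] False unfolding disc q by simp
    moreover have "(\<Sum>r\<in>Fp. qchar (?g r)) =
        qchar (- (\<gamma> * t)) * ((if \<gamma>\<^sup>2 * (s\<^sup>2 - 4 * \<gamma> * t) = 0 then int p else 0) - 1)"
      using sum_qchar_quadratic[OF cl(1) _ cl(2,3)] False unfolding disc by simp
    moreover have "qchar (- (\<gamma> * t)) = eps * qchar (\<gamma> * t)"
      using qchar_mult[of "-1" "\<gamma> * t"] t by simp
    ultimately show ?thesis using False by (simp add: M2_def)
  next
    case t0: True
    show ?thesis
    proof (cases "s = 0")
      case True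
      have "qchar (- \<gamma>\<^sup>2) = eps" using qchar_mult_square[of "-1" \<gamma>] by simp
      then show ?thesis using t0 True by (simp add: M2_def)
    next
      case False
      have "{r \<in> Fp. \<gamma> * s * r + - \<gamma>\<^sup>2 = 0} = {\<gamma> / s}"
        using s False by (auto simp: field_simps power2_eq_square)
      moreover have "(\<Sum>r\<in>Fp. qchar (\<gamma> * s * r + - \<gamma>\<^sup>2)) = 0"
        using cl False by (intro sum_qchar_affine) auto
      ultimately show ?thesis using t0 False by (simp add: M2_def)
    qed
  qed
  ultimately show ?thesis by simp
qed

abbreviation W :: real where "W \<equiv> (real p - 1)\<^sup>2 / 2 * (K\<^sup>2 / p\<^sup>2)"

definition wt_val :: "int \<Rightarrow> int \<Rightarrow> real" where
  "wt_val \<alpha> \<beta> = W + K * (M2 \<alpha> \<beta> - (p + eps * p)) / 2"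

text \<open>After the shift by 1/2, the zeros of the codeword are the \<open>y\<close> with
  \<open>Q y\<close> in \<open>S\<close> and \<open>B b y\<close> equal to
  \<open>- B b half\<close>. They are counted by \<open>card_Q_B\<close>, level by level.\<close>

lemma wt_adj:
  assumes b: "b \<notin> Rad"
  shows "real (wt (adj b)) = wt_val (qchar (\<gamma> * Q b)) (qchar ((B b half)\<^sup>2 - 4 * \<gamma> * Q b))"
proof -
  let ?t = "Q b" and ?s = "B b half"
  have "bij_betw (\<lambda>x. x - half) {x \<in> D. Tr (adj b * x) = 0} {y. Q y \<in> S \<and> B b y = - ?s}"
  proof (rule bij_betw_byWitness[where f' = "\<lambda>y. y + half"])
    have "B b (x - half) = B b x - ?s" for x
      using B_add_right[of b "x - half" half] by (metis add_diff_cancel_right' diff_add_cancel)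
    then show "(\<lambda>x. x - half) ` {x \<in> D. Tr (adj b * x) = 0} \<subseteq> {y. Q y \<in> S \<and> B b y = - ?s}"
      by (auto simp: defset_iff Tr_adj)
    show "(\<lambda>y. y + half) ` {y. Q y \<in> S \<and> B b y = - ?s} \<subseteq> {x \<in> D. Tr (adj b * x) = 0}"
      by (auto simp: defset_iff Tr_adj B_add_right)
  qed auto
  then have "card {x \<in> D. Tr (adj b * x) = 0} = card {y. Q y \<in> S \<and> B b y = - ?s}"
    by (rule bij_betw_same_card)
  also have "\<dots> = (\<Sum>u\<in>S. card {y \<in> {y. Q y \<in> S \<and> B b y = - ?s}. Q y = u})"
    by (rule card_eq_sum_fibres) auto
  also have "\<dots> = (\<Sum>u\<in>S. card {y. Q y = u \<and> B b y = - ?s})"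
    by (intro sum.cong refl arg_cong[where f = card]) auto
  finally have "real (card {x \<in> D. Tr (adj b * x) = 0}) = (\<Sum>u\<in>S. real (card {y. Q y = u \<and> B b y = - ?s}))"
    by simp
  also have "\<dots> = (\<Sum>u\<in>S. K\<^sup>2 / p\<^sup>2 + K - K * card {r \<in> Fp. ?t * r\<^sup>2 + (- ?s) * r + u = 0})"
    using S_sub b by (intro sum.cong refl card_Q_B) auto
  also have "\<dots> = card S * (K\<^sup>2 / p\<^sup>2 + K) - K * (\<Sum>u\<in>S. card {r \<in> Fp. ?t * r\<^sup>2 + (- ?s) * r + u = 0})"
    by (simp add: sum_subtractf sum_distrib_left)
  \<comment> \<open>Each \<open>r\<close> is a root for exactly one \<open>u\<close>, so summing the
    root counts over \<open>S\<close> counts the \<open>r\<close> whose \<open>u\<close> lies in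
    \<open>S\<close>.\<close>
  also have "(\<Sum>u\<in>S. card {r \<in> Fp. ?t * r\<^sup>2 + (- ?s) * r + u = 0}) = card {r \<in> Fp. - (?t * r\<^sup>2 - ?s * r) \<in> S}"
  proof -
    have "card {r \<in> Fp. - (?t * r\<^sup>2 - ?s * r) \<in> S}
        = (\<Sum>u\<in>S. card {r \<in> {r \<in> Fp. - (?t * r\<^sup>2 - ?s * r) \<in> S}. - (?t * r\<^sup>2 - ?s * r) = u})"
      by (rule card_eq_sum_fibres) auto
    also have "\<dots> = (\<Sum>u\<in>S. card {r \<in> Fp. ?t * r\<^sup>2 + (- ?s) * r + u = 0})"
    proof (intro sum.cong refl arg_cong[where f = card])
      fix u assume u: "u \<in> S"
      have gen: "{r \<in> {r \<in> Fp. X r \<in> S}. X r = u} = {r \<in> Fp. X r = u}" for X :: "'a \<Rightarrow> 'a"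
        using u by auto
      have iff: "- (?t * r\<^sup>2 - ?s * r) = u \<longleftrightarrow> ?t * r\<^sup>2 + (- ?s) * r + u = 0" for r
      proof -
        have "?t * r\<^sup>2 + (- ?s) * r + u = u - (- (?t * r\<^sup>2 - ?s * r))" by simp
        then show ?thesis by (metis right_minus_eq)
      qed
      show "{r \<in> {r \<in> Fp. - (?t * r\<^sup>2 - ?s * r) \<in> S}. - (?t * r\<^sup>2 - ?s * r) = u}
          = {r \<in> Fp. ?t * r\<^sup>2 + (- ?s) * r + u = 0}"
        unfolding iff[symmetric] by (rule gen)
    qed
    finally show ?thesis by simp
  qed
  finally have N: "real (card {x \<in> D. Tr (adj b * x) = 0}) =
      (real p - 1) / 2 * (K\<^sup>2 / p\<^sup>2 + K) - K * card {r \<in> Fp. - (?t * r\<^sup>2 - ?s * r) \<in> S}"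
    using card_S by simp
  have m: "real (card {r \<in> Fp. - (?t * r\<^sup>2 - ?s * r) \<in> S})
      = M2 (qchar (\<gamma> * ?t)) (qchar (?s\<^sup>2 - 4 * \<gamma> * ?t)) / 2"
    using arg_cong[OF card_conic_points[of ?t ?s], of real_of_int] by simp
  show ?thesis
    unfolding wt_eq card_D wt_val_def N m using p_ge_3 by (simp add: field_simps power2_eq_square)
qed

subsection \<open>The weight distribution\<close>

text \<open>By symmetry of \<open>B\<close> this is \<open>card_Q_B\<close> with 1/2 in the role of
  \<open>b\<close>. The p^2 radical vectors all sit at t = s = 0 and are removed there.\<close>

lemma card_Q_B_half:
  assumes t: "t \<in> Fp" and s: "s \<in> Fp"
  shows "real (card {b. b \<notin> Rad \<and> Q b = t \<and> B b half = s}) =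
    K\<^sup>2 / p\<^sup>2 - K * qchar (s\<^sup>2 - 4 * \<gamma> * t) - (if t = 0 \<and> s = 0 then (real p)\<^sup>2 else 0)"
proof -
  have "int (card {r \<in> Fp. \<gamma> * r\<^sup>2 + s * r + t = 0}) = 1 + qchar (s\<^sup>2 - 4 * \<gamma> * t)"
    using s t by (intro card_quadratic_roots) auto
  then have "real (card {r \<in> Fp. \<gamma> * r\<^sup>2 + s * r + t = 0}) = 1 + qchar (s\<^sup>2 - 4 * \<gamma> * t)"
    by linarith
  then have all: "real (card {b. Q b = t \<and> B half b = s}) = K\<^sup>2 / p\<^sup>2 - K * qchar (s\<^sup>2 - 4 * \<gamma> * t)"
    using card_Q_B[OF half_notin_Rad t s] unfolding Q_half by (simp add: algebra_simps)
  have split: "{b. b \<notin> Rad \<and> Q b = t \<and> B b half = s}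
      = {b. Q b = t \<and> B half b = s} - (if t = 0 \<and> s = 0 then Rad else {})"
    unfolding B_sym[of _ half] using Rad_Q Rad_B' by auto
  show ?thesis
  proof (cases "t = 0 \<and> s = 0")
    case True
    have sub: "Rad \<subseteq> {b. Q b = t \<and> B half b = s}" using True Rad_Q Rad_B' by auto
    have "real (card ({b. Q b = t \<and> B half b = s} - Rad)) = real (card {b. Q b = t \<and> B half b = s}) - real (card Rad)"
      using card_mono[OF _ sub] by (simp add: card_Diff_subset[OF _ sub] of_nat_diff)
    then show ?thesis unfolding split using True all card_ker_lin[of "-1"] by simp
  next
    case False
    show ?thesis unfolding split if_not_P[OF False] Diff_empty using all by simp
  qed
qed

text \<open>The fibres of \<open>adj\<close> are cosets of the radical, which has p^2
  elements.\<close>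

lemma card_range_adj_preimage:
  "p\<^sup>2 * card {a \<in> range adj - {0}. P a} = card {b. b \<notin> Rad \<and> P (adj b)}"
proof -
  have "card {b. b \<notin> Rad \<and> P (adj b)}
      = (\<Sum>a\<in>{a \<in> range adj - {0}. P a}. card {b \<in> {b. b \<notin> Rad \<and> P (adj b)}. adj b = a})"
    by (intro card_eq_sum_fibres) (auto simp: adj_eq_0_iff)
  also have "\<dots> = (\<Sum>a\<in>{a \<in> range adj - {0}. P a}. p\<^sup>2)"
  proof (intro sum.cong refl)
    fix a assume a: "a \<in> {a \<in> range adj - {0}. P a}"
    have "b \<notin> Rad \<and> P (adj b)" if "adj b = a" for b using a that adj_eq_0_iff[of b] by auto
    then have "{b \<in> {b. b \<notin> Rad \<and> P (adj b)}. adj b = a} = {b. adj b = a}" by blast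
    also have "card \<dots> = card {b. adj b = 0}"
      using a by (intro card_fibre_additive adj_add) auto
    finally show "card {b \<in> {b. b \<notin> Rad \<and> P (adj b)}. adj b = a} = p\<^sup>2"
      using card_ker_lin[of "-1"] by (simp add: adj_eq_0_iff)
  qed
  finally show ?thesis by simp
qed

lemma power_p_e4: "real p ^ (e - 4) = K\<^sup>2 / p ^ 4" and power_p_h2: "real p ^ (h - 2) = K / p\<^sup>2"
  using power_p_diff[OF e_ge_4] power_p_e power_p_diff[OF h_ge_2] by simp_all

lemma card_wt_range_adj:
  \<comment> \<open>\<open>G\<close> is the number of nonzero \<open>adj b\<close> per pair
    (\<open>Q b\<close>, \<open>B b half\<close>), restricted to weight \<open>w\<close>. It depends
    only on two characters, so \<open>sum_pairs_qchar\<close> evaluates the total.\<close>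
  fixes w :: nat
  defines "G \<equiv> \<lambda>\<alpha> \<beta>. (if wt_val \<alpha> \<beta> = real w then 1 else 0) *
      (real p ^ (e - 4) - real p ^ (h - 2) * \<beta> - (if \<alpha> = 0 \<and> \<beta> = 0 then 1 else 0))"
  shows "real (card {a \<in> range adj - {0}. wt a = w}) =
    G 0 0 + (real p - 1) * (G 0 1 + G 1 0) + (real p - 1) * (real p - 3) / 4 * G 1 1
    + (real p - 1)\<^sup>2 / 4 * (G 1 (-1) + G (-1) 1) + ((real p)\<^sup>2 - 1) / 4 * G (-1) (-1)"
proof -
  let ?al = "\<lambda>t. qchar (\<gamma> * t)" and ?be = "\<lambda>t s. qchar (s\<^sup>2 - 4 * \<gamma> * t)"
  have "card {b. b \<notin> Rad \<and> wt (adj b) = w} =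
      (\<Sum>z\<in>Fp \<times> Fp. card {b \<in> {b. b \<notin> Rad \<and> wt (adj b) = w}. (Q b, B b half) = z})"
    by (rule card_eq_sum_fibres) auto
  then have "real (card {b. b \<notin> Rad \<and> wt (adj b) = w}) =
      (\<Sum>t\<in>Fp. \<Sum>s\<in>Fp. real (card {b \<in> {b. b \<notin> Rad \<and> wt (adj b) = w}. (Q b, B b half) = (t, s)}))"
    by (simp only: of_nat_sum sum.cartesian_product split_def prod.collapse)
  also have "\<dots> = (\<Sum>t\<in>Fp. \<Sum>s\<in>Fp. (real p)\<^sup>2 * G (?al t) (?be t s))"
  proof (intro sum.cong refl)
    fix t s :: 'a assume ts: "t \<in> Fp" "s \<in> Fp"
    have "{b \<in> {b. b \<notin> Rad \<and> wt (adj b) = w}. (Q b, B b half) = (t, s)} =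
        (if wt_val (?al t) (?be t s) = real w then {b. b \<notin> Rad \<and> Q b = t \<and> B b half = s} else {})"
      using wt_adj by force
    then have "real (card {b \<in> {b. b \<notin> Rad \<and> wt (adj b) = w}. (Q b, B b half) = (t, s)}) =
        (if wt_val (?al t) (?be t s) = real w then 1 else 0) *
        real (card {b. b \<notin> Rad \<and> Q b = t \<and> B b half = s})"
      by (simp only: mult_1 mult_zero_left card.empty of_nat_0 split: if_split) simp
    also have "real (card {b. b \<notin> Rad \<and> Q b = t \<and> B b half = s}) = (real p)\<^sup>2 *
        (real p ^ (e - 4) - real p ^ (h - 2) * ?be t s - (if t = 0 \<and> s = 0 then 1 else 0))"
      unfolding card_Q_B_half[OF ts] power_p_e4 power_p_h2
      using p_ge_3 by (simp add: field_simps eval_nat_numeral)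
    also have "t = 0 \<and> s = 0 \<longleftrightarrow> ?al t = 0 \<and> ?be t s = 0" by auto
    finally show "real (card {b \<in> {b. b \<notin> Rad \<and> wt (adj b) = w}. (Q b, B b half) = (t, s)})
        = (real p)\<^sup>2 * G (?al t) (?be t s)"
      by (simp only: G_def mult.left_commute)
  qed
  also have "\<dots> = (real p)\<^sup>2 * (\<Sum>t\<in>Fp. \<Sum>s\<in>Fp. G (?al t) (?be t s))"
    by (simp add: sum_distrib_left)
  also have "(\<Sum>t\<in>Fp. \<Sum>s\<in>Fp. G (?al t) (?be t s))
      = (\<Sum>t\<in>Fp. \<Sum>s\<in>Fp. G (qchar (4 * \<gamma> * t + 0)) (qchar (s\<^sup>2 - (4 * \<gamma> * t + 0))))"
    by (intro sum.cong refl) (simp add: qchar_4_mult mult.assoc)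
  \<comment> \<open>The substitution is T = 4 \<gamma> t, a permutation of F_p.\<close>
  also have "\<dots> = (\<Sum>T\<in>Fp. \<Sum>s\<in>Fp. G (qchar T) (qchar (s\<^sup>2 - T)))"
    by (intro sum.reindex_bij_betw bij_betw_Fp_affine) auto
  finally have "(real p)\<^sup>2 * real (card {a \<in> range adj - {0}. wt a = w})
      = (real p)\<^sup>2 * (\<Sum>T\<in>Fp. \<Sum>s\<in>Fp. G (qchar T) (qchar (s\<^sup>2 - T)))"
    using arg_cong[OF card_range_adj_preimage[of "\<lambda>a. wt a = w"], of real] by simp
  then show ?thesis using p_ge_3 sum_pairs_qchar[of G] by simp
qed

definition wt_gen :: real where "wt_gen = (real p - 1) / p * card D"

text \<open>Splits the field into 0, the complement of the range of \<open>adj\<close>, where the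
  weight is constant, and the nonzero part of that range. Indicators are added because different
  classes may share a weight.\<close>

lemma card_wt:
  fixes w :: nat
  shows "real (card {a. wt a = w}) = (if 0 = real w then 1 else 0) * 1
    + (if wt_gen = real w then 1 else 0) * (real p ^ e - real p ^ (e - 2))
    + real (card {a \<in> range adj - {0}. wt a = w})"
proof -
  have "adj 0 = 0" using adj_add[of 0 0] by (metis add_cancel_right_right)
  then have zero: "0 \<in> range adj" by (metis rangeI)
  have wt0: "wt 0 = 0" by (simp add: wt_def)
  have wt_out: "real (wt a) = wt_gen" if "a \<notin> range adj" for a
    using wt_notin_range_adj[OF that] by (simp only: wt_gen_def)
  have part: "{a. wt a = w} = (if 0 = real w then {0} else {}) \<union> (if wt_gen = real w then - range adj else {})
      \<union> {a \<in> range adj - {0}. wt a = w}" (is "_ = ?A \<union> ?B \<union> ?C")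
  proof (rule Set.set_eqI)
    fix a
    show "a \<in> {a. wt a = w} \<longleftrightarrow> a \<in> ?A \<union> ?B \<union> ?C"
      using zero wt0 wt_out[of a] by (cases "a \<in> range adj"; cases "a = 0") auto
  qed
  have disj: "(?A \<union> ?B) \<inter> ?C = {}" "?A \<inter> ?B = {}" using zero by auto
  have "card {a. wt a = w} = card ?A + card ?B + card ?C"
    unfolding part using disj by (simp only: card_Un_disjoint finite)
  moreover have "card (- range adj) = p ^ e - p ^ (e - 2)"
    by (simp add: Compl_eq_Diff_UNIV card_Diff_subset card_field card_range_adj)
  moreover have "p ^ (e - 2) \<le> p ^ e" using p_ge_3 by (intro power_increasing) auto
  ultimately show ?thesis by (simp add: of_nat_diff)
qed

lemma eps_iff: "eps = (if p mod 4 = 1 then 1 else -1)"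
proof -
  have "of_int eps = (-1 :: 'a) ^ ((p - 1) div 2)"
    using of_int_qchar[of "-1"] by simp
  moreover have "even ((p - 1) div 2) \<longleftrightarrow> p mod 4 = 1" using odd_p by presburger
  ultimately show ?thesis using eps_cases one_neq_minus_one by (auto split: if_splits)
qed

lemma W_eq: "real ((p - 1)\<^sup>2) / 2 * real p ^ (e - 2) = W"
  using p_ge_3 e_ge_4 power_p_diff[of 2 e] power_p_e by (simp add: of_nat_diff)

lemma p_cases: "p mod 4 = 1 \<or> p mod 4 = 3"
  using odd_p by presburger

lemma K_ge: "K \<ge> (real p)\<^sup>2"
  using h_ge_2 p_ge_3 by (intro power_increasing) auto

text \<open>Serves to show that the tabulated weights remain positive after multiples of
  \<open>K\<close> are subtracted.\<close>

lemma W_ge: "W \<ge> (real p - 1)\<^sup>2 / 2 * K"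
proof -
  have "K * (real p)\<^sup>2 \<le> K * K" by (intro mult_left_mono K_ge) simp
  then have "K \<le> K\<^sup>2 / p\<^sup>2" using p_ge_3 by (simp add: field_simps power2_eq_square)
  then show ?thesis by (intro mult_left_mono) simp_all
qed

definition weights1 :: "(real \<times> real) list" where
  "weights1 = [(0, 1),
     (W - ((real p)\<^sup>2 - 1) / 2 * real p ^ (h - 1), real p ^ e - real p ^ (e - 2)),
     (W, real p ^ (e - 4) - 1),
     (W - (real p + 1) / 2 * K,
        ((real p)\<^sup>2 - 1) / 2 * real p ^ (e - 4) - (real p - 1) * real p ^ (h - 2)),
     (W - (real p + 3) / 2 * K,
        (real p - 1) * (real p - 3) / 4 * real p ^ (e - 4)
        - (real p - 1) * (real p - 3) / 4 * real p ^ (h - 2)),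
     (W - (real p - 1) / 2 * K,
        ((real p)\<^sup>2 - 1) / 4 * real p ^ (e - 4) + ((real p)\<^sup>2 - 1) / 4 * real p ^ (h - 2)),
     (W - K, (real p - 1) * real p ^ (e - 4))]"

text \<open>A list, since entries can have equal weights: for \<open>p = 3\<close> the fifth weight
  is again \<open>W\<close>.\<close>

definition weights3 :: "(real \<times> real) list" where
  "weights3 = [(0, 1),
     (W + (real p - 1)\<^sup>2 / 2 * real p ^ (h - 1), real p ^ e - real p ^ (e - 2)),
     (W, real p ^ (e - 3) - 1),
     (W + (real p - 1) / 2 * K, ((real p)\<^sup>2 - 1) / 2 * real p ^ (e - 4)),
     (W + (real p - 3) / 2 * K,
        (real p - 1)\<^sup>2 / 4 * real p ^ (e - 4) - (real p - 1)\<^sup>2 / 4 * real p ^ (h - 2)),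
     (W + (real p + 1) / 2 * K,
        (real p - 1)\<^sup>2 / 4 * real p ^ (e - 4) + (real p - 1)\<^sup>2 / 4 * real p ^ (h - 2))]"

lemma power_p_h1: "real p ^ (h - 1) = K / p" and power_p_e3: "real p ^ (e - 3) = p * real p ^ (e - 4)"
proof -
  show "real p ^ (h - 1) = K / p" using power_p_diff[of 1 h] h_ge_2 by simp
  have "e - 3 = Suc (e - 4)" using e_ge_4 by simp
  then show "real p ^ (e - 3) = p * real p ^ (e - 4)" by simp
qed

text \<open>The character pairs (0, 1), (1, -1) and (-1, 1) give the same weight and merge into one
  entry.\<close>

lemma card_wt_weights1:
  assumes "p mod 4 = 1"
  shows "real (card {a. wt a = w}) = (\<Sum>(x, n) \<leftarrow> weights1. if x = real w then n else 0)"
proof -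
  have eps1: "eps = 1" using eps_iff assms by simp
  \<comment> \<open>With the indicator hidden behind \<open>d\<close>, the claim becomes an identity
    linear in its values.\<close>
  define d where "d x = (if x = real w then 1 else 0 :: real)" for x
  have ifd: "(if x = real w then n else 0) = d x * n" for x n by (simp add: d_def)
  have gen: "wt_gen = W - ((real p)\<^sup>2 - 1) / 2 * (K / p)"
    unfolding wt_gen_def card_D eps1 using p_ge_3 by (simp add: field_simps power2_eq_square)
  have v: "wt_val 0 0 = W" "wt_val 0 1 = W - (real p + 1) / 2 * K" "wt_val 1 0 = W - K"
    "wt_val 1 1 = W - (real p + 3) / 2 * K" "wt_val 1 (-1) = W - (real p + 1) / 2 * K"
    "wt_val (-1) 1 = W - (real p + 1) / 2 * K" "wt_val (-1) (-1) = W - (real p - 1) / 2 * K"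
    unfolding wt_val_def M2_def eps1 by (simp_all add: field_simps)
  show ?thesis
    unfolding card_wt card_wt_range_adj weights1_def gen v power_p_h1 d_def[symmetric]
    by (simp add: ifd) (simp add: field_simps power2_eq_square)
qed

text \<open>Here (0, 0) and (1, 0) merge at weight \<open>W\<close>, and (0, 1), (1, 1), (-1, -1)
  merge into the fourth entry, where the terms in p^(h-2) cancel.\<close>

lemma card_wt_weights3:
  assumes "p mod 4 = 3"
  shows "real (card {a. wt a = w}) = (\<Sum>(x, n) \<leftarrow> weights3. if x = real w then n else 0)"
proof -
  have eps1: "eps = -1" using eps_iff assms by simp
  define d where "d x = (if x = real w then 1 else 0 :: real)" for x
  have ifd: "(if x = real w then n else 0) = d x * n" for x n by (simp add: d_def)
  have gen: "wt_gen = W + (real p - 1)\<^sup>2 / 2 * (K / p)"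
    unfolding wt_gen_def card_D eps1 using p_ge_3 by (simp add: field_simps power2_eq_square)
  have v: "wt_val 0 0 = W" "wt_val 0 1 = W + (real p - 1) / 2 * K" "wt_val 1 0 = W"
    "wt_val 1 1 = W + (real p - 1) / 2 * K" "wt_val 1 (-1) = W + (real p + 1) / 2 * K"
    "wt_val (-1) 1 = W + (real p - 3) / 2 * K" "wt_val (-1) (-1) = W + (real p - 1) / 2 * K"
    unfolding wt_val_def M2_def eps1 by (simp_all add: field_simps)
  show ?thesis
    unfolding card_wt card_wt_range_adj weights3_def gen v power_p_h1 power_p_e3 d_def[symmetric]
    by (simp add: ifd) (simp add: field_simps power2_eq_square)
qed

section \<open>Injectivity of the encoding and the number of nonzero weights\<close>

definition weights where "weights = (if p mod 4 = 1 then weights1 else weights3)"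

lemma card_wt_weights:
  "real (card {a. wt a = w}) = (\<Sum>(x, n) \<leftarrow> weights. if x = real w then n else 0)"
  using card_wt_weights1 card_wt_weights3 p_cases unfolding weights_def by auto

lemma weights_nonzero: "0 \<notin> fst ` set (tl weights)"
proof -
  have K: "K > 0" using p_ge_3 by simp
  show ?thesis
  proof (cases "p mod 4 = 1")
    case True
    then have "p \<noteq> 3" "p \<noteq> 4" by auto
    \<comment> \<open>The bound (p + 3)/2 < (p - 1)^2/2 used below fails for p = 3, which the
      residue class excludes.\<close>
    then have p5: "real p \<ge> 5" using p_ge_3 by simp
    have lt: "W - c * K > 0" if "c < (real p - 1)\<^sup>2 / 2" for c
    proof -
      have "c * K < (real p - 1)\<^sup>2 / 2 * K" using that K by (intro mult_strict_right_mono)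
      then show ?thesis using W_ge by linarith
    qed
    define y where "y = (real p - 1)\<^sup>2"
    have "(real p - 1) * 4 \<le> y"
      unfolding y_def power2_eq_square using p5 by (intro mult_left_mono) auto
    then have "4 * real p - 4 \<le> y" by simp
    then have "real p + 3 < y" using p5 by linarith
    then have "(real p + 3) / 2 < y / 2" by simp
    then have b: "(real p + 3) / 2 < (real p - 1)\<^sup>2 / 2" by (simp only: y_def)
    have "((real p)\<^sup>2 - 1) / 2 * (K / p) = ((real p)\<^sup>2 - 1) / (2 * p) * K" by simp
    moreover have "((real p)\<^sup>2 - 1) / (2 * p) < (real p + 3) / 2"
      using p5 by (simp add: field_simps power2_eq_square)
    ultimately have 1: "W - ((real p)\<^sup>2 - 1) / 2 * (K / p) > 0" using lt[of "((real p)\<^sup>2 - 1) / (2 * p)"] b by simp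
    have 2: "W > 0" "W - K > 0" "W - (real p + 1) / 2 * K > 0" "W - (real p + 3) / 2 * K > 0" "W - (real p - 1) / 2 * K > 0"
      using lt[of 0] lt[of 1] lt[of "(real p + 1) / 2"] lt[of "(real p + 3) / 2"] lt[of "(real p - 1) / 2"] b p5
      by simp_all
    show ?thesis
      unfolding weights_def if_P[OF True] weights1_def power_p_h1 list.sel
        list.set image_insert image_empty fst_conv insert_iff empty_iff
      using 1 2 by (metis less_irrefl)
  next
    case False
    have pos: "W > 0" using p_ge_3 by simp
    have "(real p - 1)\<^sup>2 / 2 * (K / p) \<ge> 0" "(real p - 1) / 2 * K \<ge> 0" "(real p - 3) / 2 * K \<ge> 0"
      "(real p + 1) / 2 * K \<ge> 0"
      using p_ge_3 by (auto intro!: mult_nonneg_nonneg divide_nonneg_nonneg)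
    note pos = pos this[THEN add_pos_nonneg[OF pos]]
    show ?thesis
      unfolding weights_def if_not_P[OF False] weights3_def power_p_h1 list.sel
        list.set image_insert image_empty fst_conv insert_iff empty_iff
      using pos by (metis less_irrefl)
  qed
qed

lemma weights_Cons: "weights = (0, 1) # tl weights"
  by (simp add: weights_def weights1_def weights3_def)

lemma sum_list_weights_0:
  "z \<notin> fst ` set xs \<Longrightarrow> (\<Sum>(x, n :: real) \<leftarrow> xs. if x = z then n else 0) = 0"
  by (induction xs) auto

text \<open>Read at \<open>w = 0\<close>, the distribution has only the entry (0, 1), so exactly one
  element has weight zero.\<close>

lemma wt_eq_0_iff: "wt a = 0 \<longleftrightarrow> a = 0"
proof -
  have "real (card {a. wt a = 0}) = 1"
    using card_wt_weights[of 0] sum_list_weights_0[OF weights_nonzero] by (subst (asm) weights_Cons) simp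
  then have "card {a. wt a = 0} = 1" by simp
  then obtain y where "{a. wt a = 0} = {y}" by (auto simp: card_1_singleton_iff)
  then have "wt b = 0 \<longleftrightarrow> b = y" for b by (simp add: set_eq_iff)
  moreover have "wt 0 = 0" by (simp add: wt_def)
  ultimately show ?thesis by metis
qed

lemma wt_in_weights: "a \<noteq> 0 \<Longrightarrow> real (wt a) \<in> fst ` set (tl weights)"
proof (rule ccontr)
  assume a: "a \<noteq> 0" "real (wt a) \<notin> fst ` set (tl weights)"
  then have "real (wt a) \<noteq> 0" using wt_eq_0_iff by simp
  then have "real (card {x. wt x = wt a}) = 0"
    using card_wt_weights[of "wt a"] sum_list_weights_0[OF a(2)] by (subst (asm) weights_Cons) simp
  then show False by (auto simp: card_eq_0_iff)
qed

lemma hweight_codeword: "hweight D (codeword p e D a) = wt a"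
  unfolding hweight_def wt_def codeword_def by (intro arg_cong[where f = card]) auto

text \<open>The difference of two elements with the same codeword has weight zero.\<close>

lemma inj_codeword: "inj (codeword p e D :: 'a \<Rightarrow> 'a \<Rightarrow> 'a)"
proof (rule injI)
  fix a b :: 'a assume eq: "codeword p e D a = codeword p e D b"
  have "Tr ((a - b) * x) = 0" if "x \<in> D" for x
    using fun_cong[OF eq, of x] that by (simp add: codeword_def left_diff_distrib Tr_diff)
  then have "wt (a - b) = 0" by (simp add: wt_def)
  then show "a = b" using wt_eq_0_iff by simp
qed

lemma card_code: "card (code p e D :: ('a \<Rightarrow> 'a) set) = p ^ e"
  unfolding code_def using card_image[OF inj_codeword] card_field by simp

lemma card_code_hweight:
  "card {c \<in> code p e D. hweight D c = w} = card {a :: 'a. wt a = w}"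
proof -
  have "{c \<in> code p e D. hweight D c = w} = codeword p e D ` {a :: 'a. wt a = w}"
    by (auto simp: code_def hweight_codeword)
  then show ?thesis using inj_codeword by (simp add: card_image inj_on_subset)
qed

lemma card_nonzero_weights:
  "card {hweight D c | c. c \<in> code p e D \<and> c \<noteq> (\<lambda>_. 0 :: 'a)} \<le> 6" (is "card ?X \<le> 6")
proof -
  have "codeword p e D 0 = (\<lambda>_. 0 :: 'a)" by (auto simp: codeword_def)
  then have "a \<noteq> 0" if "codeword p e D a \<noteq> (\<lambda>_. 0 :: 'a)" for a using that by metis
  then have "real ` ?X \<subseteq> fst ` set (tl weights)"
    using wt_in_weights by (auto simp: code_def hweight_codeword)
  then have "card (real ` ?X) \<le> card (set (map fst (tl weights)))" by (intro card_mono) auto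
  also have "\<dots> \<le> length (map fst (tl weights))" by (rule card_length)
  also have "\<dots> \<le> 6" by (simp add: weights_def weights1_def weights3_def)
  finally show ?thesis by (simp add: card_image inj_on_def)
qed

end

text \<open>The code is linear over F_p, so dimension \<open>e\<close> is expressed by its having
  \<open>p ^ e\<close> elements. The list sums add the multiplicities of entries whose weights
  coincide.\<close>

theorem theorem8:
  fixes p e i :: nat
  assumes "prime p" and "odd p" and "e > 0" and "e mod 4 = 0"
    and "CARD('a) = p ^ e"
    and "i \<in> {0, 1}" and "Legendre (int e) (int p) = (-1) ^ i"
  defines "D \<equiv> (defset p e i :: ('a::{field,finite}) set)"
    and "W \<equiv> real ((p - 1)^2) / 2 * real p ^ (e - 2)"
    and "h \<equiv> e div 2"
  shows "(real (card D) = real (p - 1) / 2 * real p ^ (e - 1)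
           - (1 + real_of_int (Legendre (-1) (int p)) * real p) / 2 * real p ^ h)
    \<and> card (code p e D) = p ^ e
    \<and> card {hweight D c | c. c \<in> code p e D \<and> c \<noteq> (\<lambda>_. 0)} \<le> 6
    \<and> (p mod 4 = 1 \<longrightarrow> (\<forall>w::nat. real (card {c \<in> code p e D. hweight D c = w}) =
          (\<Sum>(wt, n) \<leftarrow>
            [(0, 1),
             (W - (real p ^ 2 - 1) / 2 * real p ^ (h - 1), real p ^ e - real p ^ (e - 2)),
             (W, real p ^ (e - 4) - 1),
             (W - (real p + 1) / 2 * real p ^ h,
                (real p ^ 2 - 1) / 2 * real p ^ (e - 4) - (real p - 1) * real p ^ (h - 2)),
             (W - (real p + 3) / 2 * real p ^ h,
                (real p - 1) * (real p - 3) / 4 * real p ^ (e - 4)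
                - (real p - 1) * (real p - 3) / 4 * real p ^ (h - 2)),
             (W - (real p - 1) / 2 * real p ^ h,
                (real p ^ 2 - 1) / 4 * real p ^ (e - 4) + (real p ^ 2 - 1) / 4 * real p ^ (h - 2)),
             (W - real p ^ h, (real p - 1) * real p ^ (e - 4))].
            if wt = real w then n else 0)))
    \<and> (p mod 4 = 3 \<longrightarrow> (\<forall>w::nat. real (card {c \<in> code p e D. hweight D c = w}) =
          (\<Sum>(wt, n) \<leftarrow>
            [(0, 1),
             (W + (real p - 1) ^ 2 / 2 * real p ^ (h - 1), real p ^ e - real p ^ (e - 2)),
             (W, real p ^ (e - 3) - 1),
             (W + (real p - 1) / 2 * real p ^ h, (real p ^ 2 - 1) / 2 * real p ^ (e - 4)),
             (W + (real p - 3) / 2 * real p ^ h,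
                (real p - 1) ^ 2 / 4 * real p ^ (e - 4) - (real p - 1) ^ 2 / 4 * real p ^ (h - 2)),
             (W + (real p + 1) / 2 * real p ^ h,
                (real p - 1) ^ 2 / 4 * real p ^ (e - 4) + (real p - 1) ^ 2 / 4 * real p ^ (h - 2))].
            if wt = real w then n else 0)))"
proof -
  interpret C: trace_code p e "TYPE('a)" i
    using assms by unfold_locales
  have h: "C.h = h" by (simp add: C.h_def h_def)
  have W: "W = (real p - 1)\<^sup>2 / 2 * ((real p ^ h)\<^sup>2 / real (p\<^sup>2))"
    unfolding W_def C.W_eq h ..
  have "real p ^ (e - 1) = (real p ^ h)\<^sup>2 / p"
    using C.power_p_diff[of 1 e] C.e_pos C.power_p_e h by simp
  then have len: "real (card (defset p e i :: 'a set)) = real (p - 1) / 2 * real p ^ (e - 1)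
      - (1 + real_of_int (Legendre (-1) (int p)) * real p) / 2 * real p ^ h"
    using C.card_D C.p_ge_3 h by (simp add: of_nat_diff)
  note dist1 = C.card_wt_weights1[folded C.card_code_hweight, unfolded C.weights1_def h]
    and dist3 = C.card_wt_weights3[folded C.card_code_hweight, unfolded C.weights3_def h]
  show ?thesis
    unfolding D_def W
    by (intro conjI impI allI len C.card_code C.card_nonzero_weights dist1 dist3)
qed

end
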